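(* Consider an open bounded interval $I=\,]a,b[\,\subset\mathbb{R}$ and a measurable exponent $p\colon I\to\mathbb{R}$. Suppose the conductivity $\gamma\in L^\infty_+(I)\subset L^2(I)$, and suppose there exist constants $p^\pm$ such that almost everywhere $1<p^-<p(x)<p^+<\infty$. Then the nonlinear projection $$\widetilde P\colon L^2(I)\cap L^\infty_+(I)\to L^2(I,\sigma(p))\cap L^\infty_+(I,\sigma(p))$$ defined by $$\widetilde P(\gamma)(x)=\left(P\left(\gamma^{-1/(p-1)}\right)(x)\right)^{-(p(x)-1)}$$ can be reconstructed from the Dirichlet-to-Neumann map $\Lambda_\gamma$. Furthermore, there exists an arbitrarily small open set of Dirichlet boundary values which are sufficient for reconstructing the projection.
   Context: $L^\infty_+(I)=\{f\in L^\infty(I): \operatorname{ess\,inf} f>0\}$. Sigma-algebra and projection: $I$ carries Lebesgue measure on the Lebesgue sigma-algebra. $\sigma(p)$ is the sigma-algebra on $I$ generated by the sets $p^{-1}(A)$, $A\subseteq\mathbb{R}$ Borel. $L^r(I,\sigma(p))$ is the Lebesgue space of (almost everywhere equal) $\sigma(p)$-measurable functions with finite $L^r$-norm with respect to Lebesgue measure restricted to $\sigma(p)$; via the isometry $[g]_{\sigma(p)}\mapsto[g]$ it is identified with the closed subspace of $L^r(I)$ consisting of the classes that have a $\sigma(p)$-measurable representative. $L^\infty_+(I,\sigma(p))$ is defined analogously to $L^\infty_+(I)$. $P\colon L^2(I)\to L^2(I,\sigma(p))$ is the orthogonal projection onto this closed subspace (conditional expectation in probabilistic terms). Dirichlet-to-Neumann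 map: for $(A,B)\in\mathbb{R}^2$ let $u$ be the unique minimizer of $\int_I\frac{\gamma(x)}{p(x)}|u'(x)|^{p(x)}\,dx$ among functions in the variable exponent Sobolev space $W^{1,p(\cdot)}(I)$ with $u(a)=A$, $u(b)=B$, i.e. the weak solution of $-(\gamma|u'|^{p(x)-2}u')'=0$ in $I$ with these Dirichlet boundary values. Then $\Lambda_\gamma\colon\mathbb{R}^2\to\mathbb{R}$ is $\Lambda_\gamma(A,B)=\int_I\gamma(x)|u'(x)|^{p(x)}\,dx$. The exponent $p$ is known; the conductivity $\gamma$ is the unknown. *)

theory Defs
  imports "HOL-Probability.Probability"
begin

section \<open>Lebesgue spaces of real functions, as sets of representatives\<close>

definition L2 :: "'a measure \<Rightarrow> ('a \<Rightarrow> real) set" where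
  "L2 M = {f \<in> borel_measurable M. integrable M (\<lambda>x. (f x)\<^sup>2)}"

definition essinf :: "'a measure \<Rightarrow> ('a \<Rightarrow> real) \<Rightarrow> ereal" where
  "essinf M f = - esssup M (\<lambda>x. - ereal (f x))"

definition Linf :: "'a measure \<Rightarrow> ('a \<Rightarrow> real) set" where
  "Linf M = {f \<in> borel_measurable M. esssup M (\<lambda>x. ereal \<bar>f x\<bar>) < \<infinity>}"

definition Linf_plus :: "'a measure \<Rightarrow> ('a \<Rightarrow> real) set" where
  "Linf_plus M = {f \<in> Linf M. essinf M f > 0}"

text \<open>The variable exponent Lebesgue space: measurable functions with finite Luxemburg norm.\<close>

definition Lvar :: "'a measure \<Rightarrow> ('a \<Rightarrow> real) \<Rightarrow> ('a \<Rightarrow> real) set" where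
  "Lvar M p = {f \<in> borel_measurable M.
     \<exists>t>0. integrable M (\<lambda>x. (\<bar>f x\<bar> / t) powr p x)}"


section \<open>The sigma-algebra generated by the exponent and the nonlinear projection\<close>

definition interval_measure_space :: "real \<Rightarrow> real \<Rightarrow> real measure" where
  "interval_measure_space a b = lebesgue_on {a<..<b}"

text \<open>Lebesgue measure restricted to the sigma-algebra generated by the sets
  \<open>p -` A \<inter> {a<..<b}\<close> with \<open>A\<close> Borel.  The vimage algebra carries no useful measure of its own;
  it only supplies the sigma-algebra.\<close>

definition sigma_exponent :: "real \<Rightarrow> real \<Rightarrow> (real \<Rightarrow> real) \<Rightarrow> real measure" where
  "sigma_exponent a b p =
     restr_to_subalg (interval_measure_space a b) (vimage_algebra {a<..<b} p borel)"

text \<open>Orthogonal projection of \<open>L2 M\<close> onto the closed subspace of classes that have a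
  representative in \<open>L2 N\<close>, where \<open>N\<close> is \<open>M\<close> restricted to a sub-sigma-algebra.
  It is unique up to null sets; an \<open>N\<close>-measurable representative is chosen.\<close>

definition orth_proj :: "'a measure \<Rightarrow> 'a measure \<Rightarrow> ('a \<Rightarrow> real) \<Rightarrow> 'a \<Rightarrow> real" where
  "orth_proj M N f =
     (SOME g. g \<in> L2 N \<and> (\<forall>h\<in>L2 N. (\<integral>x. (f x - g x) * h x \<partial>M) = 0))"

definition nonlinear_proj ::
  "real \<Rightarrow> real \<Rightarrow> (real \<Rightarrow> real) \<Rightarrow> (real \<Rightarrow> real) \<Rightarrow> real \<Rightarrow> real" where
  "nonlinear_proj a b p \<gamma> x =
     (orth_proj (interval_measure_space a b) (sigma_exponent a b p)
        (\<lambda>y. \<gamma> y powr (- 1 / (p y - 1))) x) powr (- (p x - 1))"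


section \<open>The variable exponent Sobolev space on an interval\<close>

definition test_function :: "real \<Rightarrow> real \<Rightarrow> (real \<Rightarrow> real) \<Rightarrow> bool" where
  "test_function a b \<phi> \<longleftrightarrow>
     (\<forall>n x. (deriv ^^ n) \<phi> differentiable (at x)) \<and>
     (\<exists>K. compact K \<and> K \<subseteq> {a<..<b} \<and> (\<forall>x. x \<notin> K \<longrightarrow> \<phi> x = 0))"

definition locally_integrable :: "real \<Rightarrow> real \<Rightarrow> (real \<Rightarrow> real) \<Rightarrow> bool" where
  "locally_integrable a b f \<longleftrightarrow>
     (\<forall>K. compact K \<and> K \<subseteq> {a<..<b} \<longrightarrow> integrable (lebesgue_on K) f)"

definition has_weak_deriv ::
  "real \<Rightarrow> real \<Rightarrow> (real \<Rightarrow> real) \<Rightarrow> (real \<Rightarrow> real) \<Rightarrow> bool" where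
  "has_weak_deriv a b u v \<longleftrightarrow>
     locally_integrable a b u \<and> locally_integrable a b v \<and>
     (\<forall>\<phi>. test_function a b \<phi> \<longrightarrow>
        (\<integral>x. u x * deriv \<phi> x \<partial>interval_measure_space a b)
          = - (\<integral>x. v x * \<phi> x \<partial>interval_measure_space a b))"

text \<open>A representative of the weak derivative, which is unique up to null sets.\<close>

definition weak_deriv :: "real \<Rightarrow> real \<Rightarrow> (real \<Rightarrow> real) \<Rightarrow> real \<Rightarrow> real" where
  "weak_deriv a b u = (SOME v. has_weak_deriv a b u v)"

definition W1var :: "real \<Rightarrow> real \<Rightarrow> (real \<Rightarrow> real) \<Rightarrow> (real \<Rightarrow> real) set" where
  "W1var a b p = {u \<in> Lvar (interval_measure_space a b) p.
     \<exists>v\<in>Lvar (interval_measure_space a b) p. has_weak_deriv a b u v}"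


section \<open>The Dirichlet problem and the Dirichlet-to-Neumann map\<close>

text \<open>Every class in \<open>W1var a b p\<close> has a unique representative that is continuous up to the
  boundary; the boundary values are those of that representative.\<close>

definition admissible ::
  "real \<Rightarrow> real \<Rightarrow> (real \<Rightarrow> real) \<Rightarrow> real \<Rightarrow> real \<Rightarrow> (real \<Rightarrow> real) set" where
  "admissible a b p A B =
     {u \<in> W1var a b p. continuous_on {a..b} u \<and> u a = A \<and> u b = B}"

text \<open>The integrand is integrable for \<open>u\<close> in \<open>W1var a b p\<close> when \<open>p\<close> is essentially bounded and
  bounded away from 1 and \<open>\<gamma>\<close> is essentially bounded.\<close>

definition energy ::
  "real \<Rightarrow> real \<Rightarrow> (real \<Rightarrow> real) \<Rightarrow> (real \<Rightarrow> real) \<Rightarrow> (real \<Rightarrow> real) \<Rightarrow> real" where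
  "energy a b p \<gamma> u =
     (\<integral>x. \<gamma> x / p x * \<bar>weak_deriv a b u x\<bar> powr p x \<partial>interval_measure_space a b)"

definition is_minimizer ::
  "real \<Rightarrow> real \<Rightarrow> (real \<Rightarrow> real) \<Rightarrow> (real \<Rightarrow> real) \<Rightarrow> real \<Rightarrow> real \<Rightarrow> (real \<Rightarrow> real) \<Rightarrow> bool" where
  "is_minimizer a b p \<gamma> A B u \<longleftrightarrow>
     u \<in> admissible a b p A B \<and>
     (\<forall>w\<in>admissible a b p A B. energy a b p \<gamma> u \<le> energy a b p \<gamma> w)"

text \<open>The minimizer is unique on \<open>{a..b}\<close> only, its values elsewhere being irrelevant;
  hence \<open>SOME\<close> and not \<open>THE\<close>.\<close>

definition dirichlet_solution ::
  "real \<Rightarrow> real \<Rightarrow> (real \<Rightarrow> real) \<Rightarrow> (real \<Rightarrow> real) \<Rightarrow> real \<Rightarrow> real \<Rightarrow> real \<Rightarrow> real" where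
  "dirichlet_solution a b p \<gamma> A B = (SOME u. is_minimizer a b p \<gamma> A B u)"

definition DN_map ::
  "real \<Rightarrow> real \<Rightarrow> (real \<Rightarrow> real) \<Rightarrow> (real \<Rightarrow> real) \<Rightarrow> real \<times> real \<Rightarrow> real" where
  "DN_map a b p \<gamma> = (\<lambda>(A, B).
     \<integral>x. \<gamma> x * \<bar>weak_deriv a b (dirichlet_solution a b p \<gamma> A B) x\<bar> powr p x
       \<partial>interval_measure_space a b)"

end

theory Submission
  imports Defs "HOL-Real_Asymp.Real_Asymp" "HOL-Complex_Analysis.Cauchy_Integral_Formula"
begin

text \<open>
  On the interval the flux \<open>\<gamma> |u'| powr (p - 1)\<close> of a solution is a constant \<open>k\<close>, so for \<open>A < B\<close>
  one has \<open>u' = (k / \<gamma>) powr (1 / (p - 1))\<close> and \<open>\<Lambda> (A, B) = k (B - A)\<close>.  Hence the DN map on a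
  neighbourhood of \<open>(0, 1)\<close> determines the relation between \<open>k\<close> and
  \<open>B - A = \<integral> k powr (1 / (p - 1)) * \<gamma> powr (- 1 / (p - 1))\<close> for \<open>k\<close> in an interval.  With
  \<open>k = exp t\<close> the right-hand side is an entire function of \<open>t\<close>, so its restriction to
  an interval determines the exponential moments of the weight \<open>\<gamma> powr (- 1 / (p - 1))\<close>
  pushed forward by \<open>1 / (p - 1)\<close>, hence (by Levy's theorem) the pushforward itself, which is the same
  as the conditional expectation of the weight given \<open>p\<close>.
\<close>

section \<open>Smooth bump functions\<close>

text \<open>A reconstruction \<open>R\<close> is a function of the data alone, so it suffices that
  equal data on the open set force equal projections almost everywhere: \<open>R\<close> may then
  project any conductivity that fits the data. The obstacle is that weak derivatives, solutions and
  projections are all chosen by \<open>SOME\<close>. Each choice has to be pinned down up to null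
  sets before anything can be computed: weak derivatives by testing with explicit smooth bumps,
  minimizers by strict convexity, projections by conditional expectations. The data give information
  only for fluxes near some \<open>exp t\<close>, while characteristic functions live on the
  imaginary axis. The weight is therefore tilted by \<open>exp (t * rate x)\<close>, which moves the
  expansion point to 0; the Taylor coefficients there are real moments, and the same coefficients
  are summed at imaginary arguments. The tilt is measurable with respect to \<open>p\<close>, so it
  leaves the conditional expectation as a positive factor and cancels. Pushing forward by
  \<open>rate\<close> loses nothing, because \<open>p\<close> is a Borel function of
  \<open>rate\<close>.\<close>

definition expinv :: "nat \<Rightarrow> real \<Rightarrow> real" where
  "expinv n y = (if 0 < y then exp (- inverse y) * inverse y ^ n else 0)"

lemma expinv_nonneg: "0 \<le> expinv n y"
  by (simp add: expinv_def)

lemma expinv_0_le_1: "expinv 0 y \<le> 1"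
  by (simp add: expinv_def)

lemma expinv_nonpos: "y \<le> 0 \<Longrightarrow> expinv n y = 0"
  by (simp add: expinv_def)

lemma tendsto_exp_mult_power: "((\<lambda>z::real. exp (- z) * z ^ n) \<longlongrightarrow> 0) at_top"
  using tendsto_power_div_exp_0[of n] by (simp add: exp_minus field_simps)

lemma tendsto_expinv_0: "(expinv n \<longlongrightarrow> 0) (at 0)"
proof -
  have "((\<lambda>y. exp (- inverse y) * inverse y ^ n) \<longlongrightarrow> 0) (at_right (0::real))"
    by (rule filterlim_compose[OF tendsto_exp_mult_power filterlim_inverse_at_top_right])
  then have "(expinv n \<longlongrightarrow> 0) (at_right 0)"
    by (rule Lim_transform_eventually)
       (auto simp: expinv_def eventually_at_filter)
  moreover have "(expinv n \<longlongrightarrow> 0) (at_left 0)"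
    by (rule Lim_transform_eventually[OF tendsto_const])
       (auto simp: expinv_def eventually_at_filter)
  ultimately show ?thesis
    by (simp add: filterlim_split_at)
qed

text \<open>The powers of the inverse are carried along so that the family is closed under
  differentiation up to linear combinations. For \<open>n = 0\<close> the derivative is just
  \<open>expinv 2\<close>.\<close>

lemma DERIV_expinv:
  "(expinv n has_real_derivative (expinv (n + 2) y - n * expinv (n + 1) y)) (at y)"
proof (cases "y = 0")
  case True
  \<comment> \<open>Dividing by \<open>h\<close> only raises the index: the difference quotient at 0
    is \<open>expinv (Suc n)\<close> itself.\<close>
  have "((\<lambda>h. (expinv n (0 + h) - expinv n 0) / h) \<longlongrightarrow> 0) (at 0)"
  proof (rule Lim_transform_eventually[OF tendsto_expinv_0[of "Suc n"]])
    show "\<forall>\<^sub>F h in at 0. expinv (Suc n) h = (expinv n (0 + h) - expinv n 0) / h"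
      by (auto simp: expinv_def field_simps)
  qed
  then show ?thesis
    using True by (simp add: DERIV_def expinv_def)
next
  case False
  show ?thesis
  proof (cases "y < 0")
    case True
    have "((\<lambda>y. 0) has_real_derivative (expinv (n + 2) y - n * expinv (n + 1) y)) (at y)"
      using True by (simp add: expinv_def)
    then show ?thesis
      by (rule DERIV_cong_ev[THEN iffD1, rotated -1, OF _ refl _ refl])
         (use True in \<open>auto simp: expinv_def eventually_nhds intro!: exI[of _ "{..<0}"]\<close>)
  next
    case F: False
    with False have y: "0 < y" by simp
    let ?i = "inverse y"
    have "((\<lambda>y. exp (- inverse y) * inverse y ^ n) has_real_derivative
        exp (- ?i) * ?i\<^sup>2 * ?i ^ n - exp (- ?i) * (real n * ?i ^ (n - 1) * ?i\<^sup>2)) (at y)"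
      using y by (auto intro!: derivative_eq_intros simp: power2_eq_square)
    \<comment> \<open>The truncated exponent \<open>n - 1\<close> is harmless at
      \<open>n = 0\<close>, where the factor \<open>real n\<close> vanishes.\<close>
    also have "real n * ?i ^ (n - 1) * ?i\<^sup>2 = real n * ?i ^ (n + 1)"
      by (cases n) (auto simp: power2_eq_square)
    also have "exp (- ?i) * ?i\<^sup>2 * ?i ^ n - exp (- ?i) * (real n * ?i ^ (n + 1))
        = expinv (n + 2) y - n * expinv (n + 1) y"
      using y by (simp add: expinv_def power2_eq_square)
    finally have "((\<lambda>y. exp (- inverse y) * inverse y ^ n) has_real_derivative
        (expinv (n + 2) y - n * expinv (n + 1) y)) (at y)" .
    then show ?thesis
      by (rule DERIV_cong_ev[THEN iffD1, rotated -1, OF _ refl _ refl])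
         (use y in \<open>auto simp: expinv_def eventually_nhds intro!: exI[of _ "{0<..}"]\<close>)
  qed
qed

lemmas DERIV_expinv_chain = DERIV_chain2[OF DERIV_expinv]

lemma continuous_expinv: "continuous_on S (expinv n)"
  using DERIV_expinv DERIV_isCont by (blast intro: continuous_at_imp_continuous_on)

lemma borel_measurable_expinv [measurable]: "expinv n \<in> borel_measurable borel"
  by (rule borel_measurable_continuous_onI[OF continuous_expinv])

text \<open>\<open>test_function\<close> speaks of all iterated derivatives. A set closed under
  differentiation disposes of them by one induction, without a formula for the derivative of order
  \<open>n\<close>.\<close>

inductive_set bump_span :: "real \<Rightarrow> real \<Rightarrow> real \<Rightarrow> (real \<Rightarrow> real) set"
  for N c d where
  base: "(\<lambda>x. expinv i (N * (x - c)) * expinv j (N * (d - x))) \<in> bump_span N c d"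
| add: "f \<in> bump_span N c d \<Longrightarrow> g \<in> bump_span N c d \<Longrightarrow> (\<lambda>x. f x + g x) \<in> bump_span N c d"
| scale: "f \<in> bump_span N c d \<Longrightarrow> (\<lambda>x. r * f x) \<in> bump_span N c d"

lemma bump_span_DERIV:
  assumes "f \<in> bump_span N c d"
  shows "\<exists>g\<in>bump_span N c d. \<forall>x. (f has_real_derivative g x) (at x)"
  using assms
proof induction
  case (base i j)
  let ?e = "\<lambda>i j x. expinv i (N * (x - c)) * expinv j (N * (d - x))"
  let ?g = "\<lambda>x. (N * ?e (i+2) j x + (-(N * i)) * ?e (i+1) j x)
       + ((-N) * ?e i (j+2) x + (N * j) * ?e i (j+1) x)"
  have "?g \<in> bump_span N c d"
    by (intro bump_span.intros)
  moreover have "(?e i j has_real_derivative ?g x) (at x)" for x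
    by (rule derivative_eq_intros DERIV_expinv_chain refl)+ (simp add: algebra_simps)
  ultimately show ?case by - (rule bexI[of _ ?g], rule allI, assumption+)
next
  case (add f g)
  then obtain f' g' where "f' \<in> bump_span N c d" "\<forall>x. (f has_real_derivative f' x) (at x)"
    "g' \<in> bump_span N c d" "\<forall>x. (g has_real_derivative g' x) (at x)" by blast
  then show ?case
    by (intro bexI[of _ "\<lambda>x. f' x + g' x"]) (auto intro: DERIV_add bump_span.add)
next
  case (scale f r)
  then obtain g where "g\<in>bump_span N c d" "\<forall>x. (f has_real_derivative g x) (at x)" by blast
  then show ?case
    by (intro bexI[of _ "\<lambda>x. r * g x"]) (auto intro: DERIV_cmult bump_span.scale)
qed

lemma bump_span_higher_deriv:
  assumes "f \<in> bump_span N c d"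
  shows "(deriv ^^ n) f \<in> bump_span N c d"
proof (induction n)
  case (Suc n)
  from bump_span_DERIV[OF this] obtain g
    where g: "g\<in>bump_span N c d" "\<forall>x. ((deriv ^^ n) f has_real_derivative g x) (at x)"
    by blast
  then have "deriv ((deriv ^^ n) f) = g"
    by (intro ext DERIV_imp_deriv) blast
  with g show ?case by simp
qed (use assms in simp)

text \<open>\<open>N\<close> is the steepness of the two flanks: as it grows, the bump tends to the
  indicator of the open interval from \<open>c\<close> to \<open>d\<close>.\<close>

definition bump :: "real \<Rightarrow> real \<Rightarrow> real \<Rightarrow> real \<Rightarrow> real" where
  "bump N c d x = expinv 0 (N * (x - c)) * expinv 0 (N * (d - x))"

lemma test_function_bump:
  assumes "a < c" "d < b" "0 < N"
  shows "test_function a b (bump N c d)"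
  unfolding test_function_def
proof (intro conjI allI)
  have "bump N c d \<in> bump_span N c d"
    unfolding bump_def[abs_def] by (rule bump_span.base)
  from bump_span_DERIV[OF bump_span_higher_deriv[OF this]]
  show "(deriv ^^ n) (bump N c d) differentiable (at x)" for n x
    using real_differentiable_def by blast
  show "\<exists>K. compact K \<and> K \<subseteq> {a<..<b} \<and> (\<forall>x. x \<notin> K \<longrightarrow> bump N c d x = 0)"
    using assms
    by (intro exI[of _ "{c..d}"]) (auto simp: bump_def expinv_def zero_less_mult_iff)
qed

lemma deriv_bump:
  "deriv (bump N c d) x = N * expinv 2 (N * (x - c)) * expinv 0 (N * (d - x))
     - N * expinv 0 (N * (x - c)) * expinv 2 (N * (d - x))"
  unfolding bump_def[abs_def]
  by (rule DERIV_imp_deriv)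
     ((rule derivative_eq_intros DERIV_expinv_chain refl)+, simp add: numeral_2_eq_2 algebra_simps)

lemma tendsto_expinv_0_at_top: "(expinv 0 \<longlongrightarrow> 1) at_top"
proof -
  have "((\<lambda>y::real. exp (- inverse y)) \<longlongrightarrow> exp (- 0)) at_top"
    by (intro tendsto_intros tendsto_inverse_0_at_top filterlim_ident)
  then have "((\<lambda>y::real. exp (- inverse y)) \<longlongrightarrow> 1) at_top" by simp
  then show ?thesis
    by (rule Lim_transform_eventually)
       (use eventually_gt_at_top[of 0] in \<open>eventually_elim, simp add: expinv_def\<close>)
qed

text \<open>\<open>expinv 2\<close> is the derivative of \<open>expinv 0\<close>, which climbs from
  0 to 1. It is therefore a probability density and can serve as a smoothing kernel.\<close>

lemma has_bochner_integral_expinv_2: "has_bochner_integral lborel (expinv 2) 1"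
proof (rule has_bochner_integral_nn_integral)
  have "(\<integral>\<^sup>+x. ennreal (expinv 2 x) * indicator {0..} x \<partial>lborel) = ennreal (1 - expinv 0 0)"
    by (rule nn_integral_FTC_atLeast)
       (use DERIV_expinv[of 0] in \<open>auto simp: expinv_nonneg numeral_2_eq_2 intro: tendsto_expinv_0_at_top\<close>)
  also have "(\<integral>\<^sup>+x. ennreal (expinv 2 x) * indicator {0..} x \<partial>lborel) = (\<integral>\<^sup>+x. ennreal (expinv 2 x) \<partial>lborel)"
    by (rule nn_integral_cong) (auto simp: expinv_def indicator_def)
  finally show "(\<integral>\<^sup>+x. ennreal (expinv 2 x) \<partial>lborel) = ennreal 1"
    by (simp add: expinv_nonpos)
qed (auto simp: expinv_nonneg)

text \<open>Dominated convergence with the kernel \<open>expinv 2\<close>. The last factor is the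
  opposite flank of the bump, which tends to 1. As the kernel vanishes for \<open>y \<le> 0\<close>,
  a one-sided limit of \<open>U\<close> at \<open>e\<close> is enough; the sign of \<open>s\<close>
  selects the side.\<close>

lemma expinv_approx_identity:
  fixes U :: "real \<Rightarrow> real"
  assumes [measurable]: "U \<in> borel_measurable borel"
    and bdd: "\<And>x. \<bar>U x\<bar> \<le> B" and R: "0 < R"
    and lim: "\<And>y. 0 < y \<Longrightarrow> (\<lambda>n. U (e + s * y / real (Suc n))) \<longlonglongrightarrow> L"
  shows "(\<lambda>n. \<integral>y. U (e + s * y / real (Suc n)) * expinv 2 y * expinv 0 (real (Suc n) * R - y) \<partial>lborel)
    \<longlonglongrightarrow> L"
proof -
  have "(\<lambda>n. \<integral>y. U (e + s * y / real (Suc n)) * expinv 2 y * expinv 0 (real (Suc n) * R - y) \<partial>lborel)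
    \<longlonglongrightarrow> (\<integral>y. L * expinv 2 y \<partial>lborel)"
  proof (rule integral_dominated_convergence[where w="\<lambda>y. B * expinv 2 y"])
    show "integrable lborel (\<lambda>y. B * expinv 2 y)"
      using has_bochner_integral_expinv_2 by (auto simp: has_bochner_integral_iff)
    show "AE y in lborel. (\<lambda>n. U (e + s * y / real (Suc n)) * expinv 2 y * expinv 0 (real (Suc n) * R - y))
       \<longlonglongrightarrow> L * expinv 2 y"
    proof (rule AE_I2)
      fix y
      show "(\<lambda>n. U (e + s * y / real (Suc n)) * expinv 2 y * expinv 0 (real (Suc n) * R - y))
       \<longlonglongrightarrow> L * expinv 2 y"
      proof (cases "0 < y")
        case True
        have "LIM n sequentially. real (Suc n) * R - y :> at_top"
          using R by real_asymp
        from filterlim_compose[OF tendsto_expinv_0_at_top this]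
        have "(\<lambda>n. U (e + s * y / real (Suc n)) * expinv 2 y * expinv 0 (real (Suc n) * R - y))
          \<longlonglongrightarrow> L * expinv 2 y * 1"
          by (intro tendsto_intros lim True)
        then show ?thesis by simp
      qed (simp add: expinv_nonpos)
    qed
    show "AE y in lborel. norm (U (e + s * y / real (Suc n)) * expinv 2 y * expinv 0 (real (Suc n) * R - y))
       \<le> B * expinv 2 y" for n
    proof (rule AE_I2)
      fix y
      have "0 \<le> B" using bdd[of 0] by linarith
      then have "\<bar>U (e + s * y / real (Suc n))\<bar> * expinv 2 y * expinv 0 (real (Suc n) * R - y) \<le> B * expinv 2 y * 1"
        by (intro mult_mono bdd expinv_0_le_1 expinv_nonneg mult_nonneg_nonneg) auto
      then show "norm (U (e + s * y / real (Suc n)) * expinv 2 y * expinv 0 (real (Suc n) * R - y))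
       \<le> B * expinv 2 y"
        by (simp add: abs_mult expinv_nonneg)
    qed
  qed measurable
  then show ?thesis
    using has_bochner_integral_expinv_2 by (simp add: has_bochner_integral_iff)
qed

section \<open>Weak derivatives of continuous functions\<close>

lemma bump_outside: "0 < N \<Longrightarrow> x \<notin> {c<..<d} \<Longrightarrow> bump N c d x = 0"
  by (auto simp: bump_def expinv_def zero_less_mult_iff)

lemma abs_bump_le_1: "\<bar>bump N c d x\<bar> \<le> 1"
  unfolding bump_def abs_mult
  by (rule mult_le_one) (auto simp: expinv_nonneg expinv_0_le_1)

lemma tendsto_bump:
  assumes "c < x" "x < d"
  shows "(\<lambda>n. bump (real (Suc n)) c d x) \<longlonglongrightarrow> 1"
proof -
  have "LIM n sequentially. real (Suc n) * (x - c) :> at_top"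
    "LIM n sequentially. real (Suc n) * (d - x) :> at_top"
    using assms by real_asymp+
  from this[THEN filterlim_compose[OF tendsto_expinv_0_at_top]]
  have "(\<lambda>n. bump (real (Suc n)) c d x) \<longlonglongrightarrow> 1 * 1"
    unfolding bump_def by (intro tendsto_mult)
  then show ?thesis by simp
qed

lemma integrable_lebesgue_on_Icc:
  assumes "locally_integrable a b v" "a < c" "d < b"
  shows "integrable lebesgue (\<lambda>x. indicator {c..d} x * v x)"
proof -
  have "{c..d} \<subseteq> {a<..<b}"
    using assms(2,3) by (intro subsetI) auto
  with assms(1) have "integrable (lebesgue_on {c..d}) v"
    unfolding locally_integrable_def by blast
  then show ?thesis
    by (simp add: integrable_restrict_space)
qed

lemma tendsto_integral_bump:
  assumes v: "locally_integrable a b v" and cd: "a < c" "c < d" "d < b"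
  shows "(\<lambda>n. \<integral>x. v x * bump (real (Suc n)) c d x \<partial>interval_measure_space a b)
    \<longlonglongrightarrow> (\<integral>x. indicator {c<..<d} x * v x \<partial>lebesgue)"
proof -
  note int = integrable_lebesgue_on_Icc[OF v cd(1,3)]
  have [measurable]: "bump N c d \<in> borel_measurable lebesgue" for N
    unfolding bump_def[abs_def] by (rule measurable_completion) measurable
  have "(\<integral>x. v x * bump (real (Suc n)) c d x \<partial>interval_measure_space a b)
     = (\<integral>x. (indicator {c..d} x * v x) * bump (real (Suc n)) c d x \<partial>lebesgue)" for n
    unfolding interval_measure_space_def
    by (subst integral_restrict_space)
       (use cd in \<open>auto intro!: Bochner_Integration.integral_cong simp: indicator_def bump_outside\<close>)
  moreover have "(\<lambda>n. \<integral>x. (indicator {c..d} x * v x) * bump (real (Suc n)) c d x \<partial>lebesgue)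
    \<longlonglongrightarrow> (\<integral>x. indicator {c<..<d} x * (indicator {c..d} x * v x) \<partial>lebesgue)"
  proof (rule integral_dominated_convergence[where w="\<lambda>x. \<bar>indicator {c..d} x * v x\<bar>"])
    show "integrable lebesgue (\<lambda>x. \<bar>indicator {c..d} x * v x\<bar>)"
      using int by simp
    have vm [measurable]: "(\<lambda>x. indicator {c..d} x * v x) \<in> borel_measurable lebesgue"
      using int by auto
    show "(\<lambda>x. indicator {c<..<d} x * (indicator {c..d} x * v x)) \<in> borel_measurable lebesgue"
      by (intro borel_measurable_times[OF borel_measurable_indicator vm]) auto
    show "(\<lambda>x. (indicator {c..d} x * v x) * bump (real (Suc n)) c d x) \<in> borel_measurable lebesgue" for n
      by measurable
    show "AE x in lebesgue. (\<lambda>n. (indicator {c..d} x * v x) * bump (real (Suc n)) c d x)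
       \<longlonglongrightarrow> indicator {c<..<d} x * (indicator {c..d} x * v x)"
    proof (rule AE_I2)
      fix x show "(\<lambda>n. (indicator {c..d} x * v x) * bump (real (Suc n)) c d x)
       \<longlonglongrightarrow> indicator {c<..<d} x * (indicator {c..d} x * v x)"
      proof (cases "x \<in> {c<..<d}")
        case True
        then have "(\<lambda>n. (indicator {c..d} x * v x) * bump (real (Suc n)) c d x)
          \<longlonglongrightarrow> (indicator {c..d} x * v x) * 1"
          by (intro tendsto_intros tendsto_bump) auto
        with True show ?thesis by simp
      qed (simp add: bump_outside)
    qed
    show "AE x in lebesgue. norm ((indicator {c..d} x * v x) * bump (real (Suc n)) c d x)
        \<le> \<bar>indicator {c..d} x * v x\<bar>" for n
      unfolding real_norm_def abs_mult[of _ "bump _ _ _ _"]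
      by (intro AE_I2 mult_left_le abs_bump_le_1) auto
  qed
  moreover have "(\<lambda>x. indicator {c<..<d} x * (indicator {c..d} x * v x)) = (\<lambda>x. indicator {c<..<d} x * v x)"
    by (auto simp: indicator_def)
  ultimately show ?thesis by simp
qed

lemma LIMSEQ_const_div_Suc: "(\<lambda>n. c + y / real (Suc n)) \<longlonglongrightarrow> c"
  using tendsto_add[OF tendsto_const LIMSEQ_Suc[OF lim_const_over_n[of y]], of c] by simp

text \<open>The derivative of a bump is a positive kernel concentrating at \<open>c\<close> minus
  one concentrating at \<open>d\<close>. The substitutions \<open>x = c + y / N\<close> and
  \<open>x = d - y / N\<close> turn both into the approximate identity.\<close>

lemma tendsto_integral_deriv_bump:
  fixes u :: "real \<Rightarrow> real"
  assumes u: "continuous_on {a..b} u" and cd: "a < c" "c < d" "d < b"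
  shows "(\<lambda>n. \<integral>x. u x * deriv (bump (real (Suc n)) c d) x \<partial>interval_measure_space a b)
    \<longlonglongrightarrow> u c - u d"
proof -
  \<comment> \<open>Cutting off outside \<open>{c..d}\<close> makes the function globally bounded
    and Borel. The limits at \<open>c\<close> and \<open>d\<close> are taken from inside, so they
    still see \<open>u\<close>.\<close>
  define U where "U = (\<lambda>x. indicator {c..d} x * u x)"
  have ucd: "continuous_on {c..d} u"
    using cd by (intro continuous_on_subset[OF u]) auto
  have U_meas [measurable]: "U \<in> borel_measurable borel"
    using borel_measurable_continuous_on_indicator[OF _ ucd] by (simp add: U_def)
  obtain B where B: "\<And>x. \<bar>U x\<bar> \<le> B"
  proof -
    have "bounded (u ` {c..d})"
      using compact_continuous_image[OF ucd] compact_imp_bounded by blast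
    then obtain B where "\<forall>y\<in>u ` {c..d}. norm y \<le> B" by (auto simp: bounded_iff)
    then have "\<bar>U x\<bar> \<le> max B 0" for x
      by (auto simp: U_def indicator_def le_max_iff_disj)
    then show thesis by (rule that)
  qed
  have lim1: "(\<lambda>n. U (c + 1 * y / real (Suc n))) \<longlonglongrightarrow> u c" if "0 < y" for y
  proof -
    have "(\<lambda>n. c + y / real (Suc n)) \<longlonglongrightarrow> c" using LIMSEQ_const_div_Suc[of c y] by simp
    then have "(\<lambda>n. u (c + y / real (Suc n))) \<longlonglongrightarrow> u c"
      by (rule isCont_tendsto_compose[rotated]) (use continuous_on_interior[OF u, of c] cd in simp)
    moreover have "\<forall>\<^sub>F n in sequentially. u (c + y / real (Suc n)) = U (c + 1 * y / real (Suc n))"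
    proof -
      have "\<forall>\<^sub>F n in sequentially. c + y / real (Suc n) < d"
        using cd \<open>0 < y\<close> by real_asymp
      then show ?thesis
        by eventually_elim (use \<open>0 < y\<close> in \<open>auto simp: U_def\<close>)
    qed
    ultimately show ?thesis by (rule Lim_transform_eventually)
  qed
  have lim2: "(\<lambda>n. U (d + (-1) * y / real (Suc n))) \<longlonglongrightarrow> u d" if "0 < y" for y
  proof -
    have "(\<lambda>n. d + (-1) * y / real (Suc n)) \<longlonglongrightarrow> d" using LIMSEQ_const_div_Suc[of d "-y"] by simp
    then have "(\<lambda>n. u (d + (-1) * y / real (Suc n))) \<longlonglongrightarrow> u d"
      by (rule isCont_tendsto_compose[rotated]) (use continuous_on_interior[OF u, of d] cd in simp)
    moreover have "\<forall>\<^sub>F n in sequentially. u (d + (-1) * y / real (Suc n)) = U (d + (-1) * y / real (Suc n))"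
    proof -
      have "\<forall>\<^sub>F n in sequentially. c < d - y / real (Suc n)"
        using cd \<open>0 < y\<close> by real_asymp
      then show ?thesis
        by eventually_elim (use \<open>0 < y\<close> in \<open>auto simp: U_def\<close>)
    qed
    ultimately show ?thesis by (rule Lim_transform_eventually)
  qed
  \<comment> \<open>The integrand after substitution; the Jacobian \<open>1 / N\<close> cancels the
    factor \<open>N\<close> of the derivative.\<close>
  define G where "G = (\<lambda>e s n y. U (e + s * y / real (Suc n)) * expinv 2 y * expinv 0 (real (Suc n) * (d - c) - y))"
  have G_int: "integrable lborel (G e s n)" for e s n
  proof (rule Bochner_Integration.integrable_bound)
    show "integrable lborel (\<lambda>y. B * expinv 2 y)"
      using has_bochner_integral_expinv_2 by (auto simp: has_bochner_integral_iff)
    show "AE y in lborel. norm (G e s n y) \<le> norm (B * expinv 2 y)"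
    proof (rule AE_I2)
      fix y
      have "0 \<le> B" using B[of 0] by linarith
      then have "\<bar>U (e + s * y / real (Suc n))\<bar> * expinv 2 y * expinv 0 (real (Suc n) * (d - c) - y) \<le> B * expinv 2 y * 1"
        by (intro mult_mono B expinv_0_le_1 expinv_nonneg mult_nonneg_nonneg) auto
      then show "norm (G e s n y) \<le> norm (B * expinv 2 y)"
        using \<open>0 \<le> B\<close> by (simp add: abs_mult expinv_nonneg G_def)
    qed
    show "G e s n \<in> borel_measurable lborel"
      unfolding G_def by measurable
  qed
  have eq: "(\<integral>x. u x * deriv (bump (real (Suc n)) c d) x \<partial>interval_measure_space a b)
     = (\<integral>y. G c 1 n y \<partial>lborel) - (\<integral>y. G d (-1) n y \<partial>lborel)" for n
  proof -
    define N where "N = real (Suc n)"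
    have N: "N > 0" by (simp add: N_def)
    define h1 where "h1 = (\<lambda>x. U x * (N * expinv 2 (N * (x - c)) * expinv 0 (N * (d - x))))"
    define h2 where "h2 = (\<lambda>x. U x * (N * expinv 0 (N * (x - c)) * expinv 2 (N * (d - x))))"
    have [measurable]: "h1 \<in> borel_measurable borel" "h2 \<in> borel_measurable borel"
      unfolding h1_def h2_def by measurable
    have e1: "(\<lambda>y. h1 (c + (1/N) * y)) = (\<lambda>y. N * G c 1 n y)"
      and e2: "(\<lambda>y. h2 (d + (-1/N) * y)) = (\<lambda>y. N * G d (-1) n y)"
      using N unfolding h1_def h2_def G_def N_def[symmetric]
      by (auto simp: algebra_simps intro!: ext)
    have i1: "integrable lborel h1"
    proof (rule lborel_integrable_real_affine_iff[of "1/N" h1 c, THEN iffD1])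
      show "integrable lborel (\<lambda>y. h1 (c + (1/N) * y))"
        unfolding e1 by (simp add: G_int)
    qed (use N in simp)
    have i2: "integrable lborel h2"
    proof (rule lborel_integrable_real_affine_iff[of "-1/N" h2 d, THEN iffD1])
      show "integrable lborel (\<lambda>y. h2 (d + (-1/N) * y))"
        unfolding e2 by (simp add: G_int)
    qed (use N in simp)
    have "(\<integral>x. u x * deriv (bump N c d) x \<partial>interval_measure_space a b)
      = (\<integral>x. h1 x - h2 x \<partial>lebesgue)"
      unfolding interval_measure_space_def
      by (subst integral_restrict_space)
         (use cd N in \<open>auto intro!: Bochner_Integration.integral_cong
           simp: indicator_def deriv_bump h1_def h2_def U_def expinv_def zero_less_mult_iff algebra_simps\<close>)
    also have "\<dots> = (\<integral>x. h1 x - h2 x \<partial>lborel)"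
      by (rule integral_completion) measurable
    also have "\<dots> = (\<integral>x. h1 x \<partial>lborel) - (\<integral>x. h2 x \<partial>lborel)"
      using i1 i2 by simp
    also have "(\<integral>x. h1 x \<partial>lborel) = (\<integral>y. G c 1 n y \<partial>lborel)"
      using lborel_integral_real_affine[of "1/N" h1 c] N unfolding e1 by simp
    also have "(\<integral>x. h2 x \<partial>lborel) = (\<integral>y. G d (-1) n y \<partial>lborel)"
      using lborel_integral_real_affine[of "-1/N" h2 d] N unfolding e2 by simp
    finally show ?thesis by (simp add: N_def)
  qed
  have "(\<lambda>n. (\<integral>y. G c 1 n y \<partial>lborel) - (\<integral>y. G d (-1) n y \<partial>lborel)) \<longlonglongrightarrow> u c - u d"
    unfolding G_def using cd
    by (intro tendsto_diff expinv_approx_identity[OF U_meas B] lim1 lim2) auto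
  then show ?thesis by (simp only: eq)
qed

text \<open>Test the weak derivative with bumps of growing steepness and compare the limits of the
  two sides.\<close>

lemma has_weak_deriv_ftc:
  assumes w: "has_weak_deriv a b u v" and u: "continuous_on {a..b} u"
    and cd: "a < c" "c < d" "d < b"
  shows "(\<integral>x. indicator {c<..<d} x * v x \<partial>lebesgue) = u d - u c"
proof -
  have v: "locally_integrable a b v"
    using w by (simp add: has_weak_deriv_def)
  have "(\<integral>x. u x * deriv (bump (real (Suc n)) c d) x \<partial>interval_measure_space a b)
     = - (\<integral>x. v x * bump (real (Suc n)) c d x \<partial>interval_measure_space a b)" for n
    using w test_function_bump[OF cd(1,3), of "real (Suc n)"] by (simp add: has_weak_deriv_def)
  then have "(\<lambda>n. - (\<integral>x. v x * bump (real (Suc n)) c d x \<partial>interval_measure_space a b)) \<longlonglongrightarrow> u c - u d"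
    using tendsto_integral_deriv_bump[OF u cd] by simp
  from LIMSEQ_unique[OF this tendsto_minus[OF tendsto_integral_bump[OF v cd]]]
  show ?thesis by simp
qed

lemma Ioo_exhaust:
  fixes a b :: real
  assumes "a < b"
  obtains c d where "\<And>n::nat. a < c n" "\<And>n. c n < d n" "\<And>n. d n < b" "c \<longlonglongrightarrow> a" "d \<longlonglongrightarrow> b"
proof
  \<comment> \<open>At most a third of the length is cut off at each end, so
    \<open>c n < d n\<close> holds already for \<open>n = 0\<close>.\<close>
  define r where "r n = (b - a) / 3 / real (Suc n)" for n
  have r: "0 < r n" "r n \<le> (b - a) / 3" for n
    using assms divide_left_mono[of 1 "real (Suc n)" "(b - a) / 3"] by (auto simp: r_def)
  show "a < a + r n" "b - r n < b" for n
    using r(1)[of n] by auto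
  show "a + r n < b - r n" for n
  proof -
    have "3 * r n \<le> b - a" using r(2)[of n] by simp
    then show ?thesis using assms r(1)[of n] by linarith
  qed
  have "r \<longlonglongrightarrow> 0"
    unfolding r_def by (rule LIMSEQ_Suc[OF lim_const_over_n])
  then show "(\<lambda>n. a + r n) \<longlonglongrightarrow> a" "(\<lambda>n. b - r n) \<longlonglongrightarrow> b"
    by (auto intro!: tendsto_eq_intros)
qed

lemma tendsto_indicator_Ioo:
  fixes a b x :: real and c d :: "nat \<Rightarrow> real"
  assumes "c \<longlonglongrightarrow> a" "d \<longlonglongrightarrow> b" "x \<in> {a<..<b}"
  shows "(\<lambda>n. indicator {c n<..<d n} x * (r::real)) \<longlonglongrightarrow> r"
proof (rule Lim_transform_eventually[OF tendsto_const])
  have "\<forall>\<^sub>F n in sequentially. c n < x" "\<forall>\<^sub>F n in sequentially. x < d n"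
    using assms by (auto intro: order_tendstoD)
  then show "\<forall>\<^sub>F n in sequentially. r = indicator {c n<..<d n} x * r"
    by eventually_elim auto
qed

text \<open>On a compact subinterval the positive and negative parts of \<open>f\<close> are
  densities of two finite measures that agree on all rays. The measures coincide, so the densities
  do, and a number equal to its own negative under truncation is 0.\<close>

lemma AE_zero_if_integral_Ioo_zero:
  fixes f :: "real \<Rightarrow> real"
  assumes f: "locally_integrable a b f"
    and zero: "\<And>c d. a < c \<Longrightarrow> c < d \<Longrightarrow> d < b \<Longrightarrow> (\<integral>x. indicator {c<..<d} x * f x \<partial>lebesgue) = 0"
  shows "AE x in interval_measure_space a b. f x = 0"
proof -
  have *: "AE x in lebesgue. x \<in> {c<..<d} \<longrightarrow> f x = 0" if cd: "a < c" "c < d" "d < b" for c d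
  proof -
    define F where "F = (\<lambda>x. indicator {c<..<d} x * f x)"
    have F: "integrable lebesgue F"
    proof -
      have "integrable lebesgue (\<lambda>x. indicator {c<..<d} x *\<^sub>R (indicator {c..d} x * f x))"
        by (rule integrable_mult_indicator[OF _ integrable_lebesgue_on_Icc[OF f cd(1,3)]]) simp
      also have "(\<lambda>x. indicator {c<..<d} x *\<^sub>R (indicator {c..d} x * f x)) = F"
        by (auto simp: F_def indicator_def)
      finally show ?thesis .
    qed
    \<comment> \<open>The comparison of measures on rays concerns Borel measures, whereas
      \<open>F\<close> is only Lebesgue measurable.\<close>
    then obtain g where g [measurable]: "g \<in> borel_measurable lborel" and Fg: "AE x in lborel. F x = g x"
      using completion_ex_borel_measurable_real by (metis borel_measurable_integrable)
    have Fg': "AE x in lebesgue. F x = g x"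
      by (rule AE_completion[OF Fg])
    have g_leb: "integrable lebesgue g"
      using F Fg' by (subst integrable_cong_AE[where g=F]) (auto intro: measurable_completion)
    then have g_int: "integrable lborel g"
      by (simp add: integrable_completion)
    have rays: "(\<integral>x. indicator {y<..} x * g x \<partial>lborel) = 0" for y
    proof -
      have "(\<integral>x. indicator {y<..} x * g x \<partial>lborel) = (\<integral>x. indicator {y<..} x * g x \<partial>lebesgue)"
        by (rule integral_completion[symmetric]) measurable
      also have "\<dots> = (\<integral>x. indicator {y<..} x * F x \<partial>lebesgue)"
        using Fg' F g_leb by (intro integral_cong_AE) (auto intro!: borel_measurable_times borel_measurable_indicator)
      also have "\<dots> = (\<integral>x. indicator {max c y<..<d} x * f x \<partial>lebesgue)"
        by (intro Bochner_Integration.integral_cong) (auto simp: F_def indicator_def)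
      also have "\<dots> = 0"
      proof (cases "max c y < d")
        case True
        then show ?thesis using cd by (intro zero) auto
      qed (auto simp: greaterThanLessThan_empty_iff2 not_less)
      finally show ?thesis .
    qed
    have ip: "integrable lborel (\<lambda>x. indicator {y<..} x * max 0 (g x))"
      and im: "integrable lborel (\<lambda>x. indicator {y<..} x * max 0 (- g x))" for y
      using integrable_mult_indicator[of "{y<..}" lborel "\<lambda>x. max 0 (g x)"]
        integrable_mult_indicator[of "{y<..}" lborel "\<lambda>x. max 0 (- g x)"] g_int
      by auto
    \<comment> \<open>Since \<open>ennreal\<close> sends negative numbers to 0, the density of
      \<open>s * g\<close> is the positive part of \<open>g\<close> for \<open>s = 1\<close> and the
      negative part for \<open>s = -1\<close>.\<close>
    have em: "emeasure (density lborel (\<lambda>x. ennreal (s * g x))) {y<..}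
        = ennreal (\<integral>x. indicator {y<..} x * max 0 (s * g x) \<partial>lborel)" if "s = 1 \<or> s = -1" for s y
    proof -
      have "emeasure (density lborel (\<lambda>x. ennreal (s * g x))) {y<..} 
         = (\<integral>\<^sup>+x. ennreal (indicator {y<..} x * max 0 (s * g x)) \<partial>lborel)"
        by (subst emeasure_density) (auto intro!: nn_integral_cong simp: indicator_def max_def ennreal_neg)
      also have "\<dots> = ennreal (\<integral>x. indicator {y<..} x * max 0 (s * g x) \<partial>lborel)"
        using ip im that by (intro nn_integral_eq_integral) auto
      finally show ?thesis .
    qed
    have "density lborel (\<lambda>x. ennreal (1 * g x)) = density lborel (\<lambda>x. ennreal ((-1) * g x))"
    proof (rule measure_eqI_lessThan)
      fix y
      have "(\<integral>x. indicator {y<..} x * max 0 (g x) \<partial>lborel) - (\<integral>x. indicator {y<..} x * max 0 (- g x) \<partial>lborel)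
         = (\<integral>x. indicator {y<..} x * g x \<partial>lborel)"
        by (subst Bochner_Integration.integral_diff[OF ip im, symmetric])
           (auto simp: max_def intro!: Bochner_Integration.integral_cong)
      then show "emeasure (density lborel (\<lambda>x. ennreal (1 * g x))) {y<..}
        = emeasure (density lborel (\<lambda>x. ennreal ((-1) * g x))) {y<..}"
        using em[of 1 y] em[of "-1" y] rays[of y] by simp
      show "emeasure (density lborel (\<lambda>x. ennreal (1 * g x))) {y<..} < \<infinity>"
        by (subst em) auto
    qed auto
    then have "AE x in lborel. ennreal (1 * g x) = ennreal ((-1) * g x)"
      by (subst (asm) sigma_finite_measure.density_unique_iff[OF sigma_finite_lborel]) auto
    moreover have "r = 0" if "ennreal (1 * r) = ennreal ((-1) * r)" for r :: real
      using that by (cases "0 \<le> r") (auto simp: ennreal_neg dest: sym)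
    ultimately have "AE x in lborel. F x = 0"
      using Fg by (auto elim!: eventually_elim2)
    then have "AE x in lebesgue. F x = 0"
      by (rule AE_completion)
    then show ?thesis
      by eventually_elim (auto simp: F_def)
  qed
  have "AE x in lebesgue. x \<in> {a<..<b} \<longrightarrow> f x = 0" if "a < b"
  proof -
    obtain c d where cd: "\<And>n::nat. a < c n" "\<And>n. c n < d n" "\<And>n. d n < b" "c \<longlonglongrightarrow> a" "d \<longlonglongrightarrow> b"
      by (rule Ioo_exhaust[OF \<open>a < b\<close>]) blast
    have "AE x in lebesgue. \<forall>n. x \<in> {c n<..<d n} \<longrightarrow> f x = 0"
      unfolding AE_all_countable by (intro allI * cd)
    then show ?thesis
    proof eventually_elim
      case (elim x)
      show ?case
      proof
        assume x: "x \<in> {a<..<b}"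
        have "indicator {c n<..<d n} x * f x = 0" for n
          using elim by (auto simp: indicator_def)
        then have "(\<lambda>n. indicator {c n<..<d n} x * f x) = (\<lambda>n. 0)" by blast
        then show "f x = 0"
          using tendsto_indicator_Ioo[OF cd(4,5) x, of "f x"] by (simp add: LIMSEQ_const_iff)
      qed
    qed
  qed
  then have "AE x in lebesgue. x \<in> {a<..<b} \<longrightarrow> f x = 0"
    by (cases "a < b") auto
  then show ?thesis
    unfolding interval_measure_space_def
    by (subst AE_restrict_space_iff) auto
qed

section \<open>Variable exponent spaces on the interval and uniqueness of weak derivatives\<close>

locale exponent_interval =
  fixes a b pm pp :: real and p :: "real \<Rightarrow> real"
  assumes ab: "a < b"
    and p_meas [measurable]: "p \<in> borel_measurable (interval_measure_space a b)"
    and pm: "1 < pm"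
    and p_AE: "AE x in interval_measure_space a b. pm < p x \<and> p x < pp"
begin

abbreviation I :: "real measure" where
  "I \<equiv> interval_measure_space a b"

lemma space_I [simp]: "space I = {a<..<b}"
  by (simp add: interval_measure_space_def)

sublocale I: finite_measure I
  unfolding interval_measure_space_def by (rule finite_measure_lebesgue_on) simp

lemma emeasure_I: "emeasure I (space I) = ennreal (b - a)"
  using ab by (simp add: interval_measure_space_def emeasure_restrict_space)

lemma ae_filter_I: "ae_filter I \<noteq> bot"
  using ab by (simp add: ae_filter_eq_bot_iff emeasure_I del: space_I)

lemma pm_less_pp: "pm < pp"
proof -
  from p_AE have "AE x in I. pm < pp" by eventually_elim auto
  then show ?thesis using ae_filter_I by simp
qed

lemma borel_measurable_I: "f \<in> borel_measurable borel \<Longrightarrow> f \<in> borel_measurable I"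
  unfolding interval_measure_space_def
  by (intro measurable_restrict_space1 measurable_completion) simp

lemma measurable_ident_I: "(\<lambda>x. x) \<in> borel_measurable I"
  by (rule borel_measurable_I) simp

lemma integral_I: "(\<integral>x. f x \<partial>I) = (\<integral>x. indicator {a<..<b} x * f x \<partial>lebesgue)" for f :: "real \<Rightarrow> real"
  unfolding interval_measure_space_def by (subst integral_restrict_space) auto

lemma integrable_I: "integrable I f \<longleftrightarrow> integrable lebesgue (\<lambda>x. indicator {a<..<b} x * f x)" for f :: "real \<Rightarrow> real"
  unfolding interval_measure_space_def by (subst integrable_restrict_space) auto

lemma AE_I_neq: "AE x in I. x \<noteq> y"
  unfolding interval_measure_space_def
  by (subst AE_restrict_space_iff) (auto intro!: AE_completion eventually_mono[OF AE_lborel_singleton[of y]])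

lemma integrable_bounded_I:
  assumes "f \<in> borel_measurable I" "AE x in I. \<bar>f x\<bar> \<le> (B::real)"
  shows "integrable I f"
  using assms by (intro I.integrable_const_bound[where B=B]) auto

lemma Linf_plus_bounds:
  assumes "\<gamma> \<in> Linf_plus I"
  obtains c C where "0 < c" "\<gamma> \<in> borel_measurable I" "AE x in I. c \<le> \<gamma> x \<and> \<gamma> x \<le> C"
proof -
  from assms have m: "\<gamma> \<in> borel_measurable I" and S: "esssup I (\<lambda>x. ereal \<bar>\<gamma> x\<bar>) < \<infinity>"
    and P: "0 < - esssup I (\<lambda>x. - ereal (\<gamma> x))"
    by (auto simp: Linf_plus_def Linf_def essinf_def)
  obtain C where C: "esssup I (\<lambda>x. ereal \<bar>\<gamma> x\<bar>) \<le> ereal C"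
    using S by (cases "esssup I (\<lambda>x. ereal \<bar>\<gamma> x\<bar>)") auto
  obtain c where c: "0 < c" "esssup I (\<lambda>x. - ereal (\<gamma> x)) \<le> ereal (- c)"
  proof (cases "esssup I (\<lambda>x. - ereal (\<gamma> x))")
    case (real r)
    then show ?thesis using P that[of "-r"] by auto
  next
    case MInf
    then show ?thesis using that[of 1] by auto
  qed (use P in auto)
  have "AE x in I. c \<le> \<gamma> x \<and> \<gamma> x \<le> C"
    using esssup_AE[of "\<lambda>x. ereal \<bar>\<gamma> x\<bar>" I] esssup_AE[of "\<lambda>x. - ereal (\<gamma> x)" I]
  proof eventually_elim
    case (elim x)
    from order_trans[OF elim(1) C] order_trans[OF elim(2) c(2)] show ?case by auto
  qed
  with c(1) m show thesis by (rule that)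
qed

lemma Lvar_bounded:
  assumes f [measurable]: "f \<in> borel_measurable I" and B: "AE x in I. \<bar>f x\<bar> \<le> B"
  shows "f \<in> Lvar I p"
proof -
  \<comment> \<open>This scale brings \<open>\<bar>f x\<bar> / t\<close> into the unit interval,
    where every positive exponent keeps it below 1. The summand 1 keeps \<open>t\<close> positive
    for \<open>B = 0\<close>.\<close>
  define t where "t = 1 + \<bar>B\<bar>"
  have t: "0 < t" by (simp add: t_def)
  have "AE x in I. norm ((\<bar>f x\<bar> / t) powr p x) \<le> 1"
    using B p_AE
  proof eventually_elim
    case (elim x)
    then have "\<bar>f x\<bar> / t \<le> 1" using t by (auto simp: t_def field_simps)
    then have "(\<bar>f x\<bar> / t) powr p x \<le> 1 powr p x"
      using elim pm t by (intro powr_mono2) auto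
    then show ?case by simp
  qed
  then have "integrable I (\<lambda>x. (\<bar>f x\<bar> / t) powr p x)"
    by (intro I.integrable_const_bound[where B=1]) measurable
  with f t show ?thesis by (auto simp: Lvar_def)
qed

text \<open>With exponents bounded by \<open>pp\<close>, removing the scale \<open>t\<close> of the
  Luxemburg norm costs at most the constant factor \<open>(max 1 t) powr pp\<close>.\<close>

lemma Lvar_integrable_powr:
  assumes "f \<in> Lvar I p"
  shows "integrable I (\<lambda>x. \<bar>f x\<bar> powr p x)"
proof -
  from assms obtain t where f [measurable]: "f \<in> borel_measurable I" and t: "0 < t"
    and i: "integrable I (\<lambda>x. (\<bar>f x\<bar> / t) powr p x)"
    by (auto simp: Lvar_def)
  show ?thesis
  proof (rule Bochner_Integration.integrable_bound)
    show "integrable I (\<lambda>x. (max 1 t) powr pp * (\<bar>f x\<bar> / t) powr p x)"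
      using i by simp
    show "AE x in I. norm (\<bar>f x\<bar> powr p x) \<le> norm ((max 1 t) powr pp * (\<bar>f x\<bar> / t) powr p x)"
      using p_AE
    proof eventually_elim
      case (elim x)
      have "\<bar>f x\<bar> powr p x = t powr p x * (\<bar>f x\<bar> / t) powr p x"
        using t by (simp add: powr_divide)
      also have "t powr p x \<le> (max 1 t) powr p x"
        using t elim pm by (intro powr_mono2) auto
      also have "(max 1 t) powr p x \<le> (max 1 t) powr pp"
        using elim by (intro powr_mono) auto
      finally show ?case by (simp add: mult_right_mono)
    qed
  qed measurable
qed

text \<open>Because \<open>1 < p x\<close>, the function is dominated by
  \<open>1 + \<bar>f x\<bar> powr p x\<close>, and constants are integrable on a bounded
  interval.\<close>

lemma Lvar_integrable:
  assumes "f \<in> Lvar I p"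
  shows "integrable I f"
proof (rule Bochner_Integration.integrable_bound)
  show "integrable I (\<lambda>x. 1 + \<bar>f x\<bar> powr p x)"
    using Lvar_integrable_powr[OF assms] by simp
  show "f \<in> borel_measurable I"
    using assms by (simp add: Lvar_def)
  show "AE x in I. norm (f x) \<le> norm (1 + \<bar>f x\<bar> powr p x)"
    using p_AE
  proof eventually_elim
    case (elim x)
    show ?case
    proof (cases "\<bar>f x\<bar> \<le> 1")
      case False
      then have "\<bar>f x\<bar> powr 1 \<le> \<bar>f x\<bar> powr p x"
        using elim pm by (intro powr_mono) auto
      with False show ?thesis by simp
    qed (simp add: add_increasing2)
  qed
qed

lemma locally_integrable_measurable:
  assumes "locally_integrable a b v"
  shows "v \<in> borel_measurable I"
proof -
  obtain c d where cd: "\<And>n::nat. a < c n" "\<And>n. c n < d n" "\<And>n. d n < b" "c \<longlonglongrightarrow> a" "d \<longlonglongrightarrow> b"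
    by (rule Ioo_exhaust[OF ab]) blast
  show ?thesis
  proof (rule borel_measurable_LIMSEQ_real)
    show "(\<lambda>n. indicator {c n<..<d n} x * v x) \<longlonglongrightarrow> v x" if "x \<in> space I" for x
      using that by (intro tendsto_indicator_Ioo[OF cd(4,5)]) simp
    show "(\<lambda>x. indicator {c n<..<d n} x * v x) \<in> borel_measurable I" for n
    proof -
      have "(\<lambda>x. indicator {c n<..<d n} x * (indicator {c n..d n} x * v x)) \<in> borel_measurable lebesgue"
        using integrable_lebesgue_on_Icc[OF assms cd(1)[of n] cd(3)[of n]]
        by (intro borel_measurable_times[OF borel_measurable_indicator borel_measurable_integrable]) auto
      moreover have "(\<lambda>x. indicator {c n<..<d n} x * (indicator {c n..d n} x * v x))
          = (\<lambda>x. indicator {c n<..<d n} x * v x)"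
        by (auto simp: indicator_def)
      ultimately show ?thesis
        unfolding interval_measure_space_def by (simp only: measurable_restrict_space1)
    qed
  qed
qed

text \<open>This makes the choice in \<open>weak_deriv\<close> harmless: both candidates integrate
  to \<open>u d - u c\<close> over every interior subinterval, so their difference vanishes almost
  everywhere.\<close>

lemma weak_deriv_unique:
  assumes "has_weak_deriv a b u v" "has_weak_deriv a b u w" "continuous_on {a..b} u"
  shows "AE x in I. v x = w x"
proof -
  have li: "locally_integrable a b v" "locally_integrable a b w"
    using assms by (auto simp: has_weak_deriv_def)
  have "AE x in I. v x - w x = 0"
  proof (rule AE_zero_if_integral_Ioo_zero)
    show "locally_integrable a b (\<lambda>x. v x - w x)"
      using li by (auto simp: locally_integrable_def)
    fix c d assume cd: "a < c" "c < d" "d < b"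
    have i: "integrable lebesgue (\<lambda>x. indicator {c<..<d} x * f x)" if "locally_integrable a b f" for f
    proof -
      have "integrable lebesgue (\<lambda>x. indicator {c<..<d} x *\<^sub>R (indicator {c..d} x * f x))"
        by (rule integrable_mult_indicator[OF _ integrable_lebesgue_on_Icc[OF that cd(1,3)]]) simp
      also have "(\<lambda>x. indicator {c<..<d} x *\<^sub>R (indicator {c..d} x * f x)) = (\<lambda>x. indicator {c<..<d} x * f x)"
        by (auto simp: indicator_def)
      finally show ?thesis .
    qed
    show "(\<integral>x. indicator {c<..<d} x * (v x - w x) \<partial>lebesgue) = 0"
      using has_weak_deriv_ftc[OF assms(1,3) cd] has_weak_deriv_ftc[OF assms(2,3) cd]
      by (simp add: right_diff_distrib i li)
  qed
  then show ?thesis by simp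
qed

text \<open>Exhaust the interval from inside. Continuity of \<open>u\<close> up to the endpoints is
  what links the derivative to the Dirichlet values.\<close>

lemma has_weak_deriv_ftc_total:
  assumes w: "has_weak_deriv a b u v" and u: "continuous_on {a..b} u" and v: "integrable I v"
  shows "(\<integral>x. v x \<partial>I) = u b - u a"
proof -
  obtain c d where cd: "\<And>n::nat. a < c n" "\<And>n. c n < d n" "\<And>n. d n < b" "c \<longlonglongrightarrow> a" "d \<longlonglongrightarrow> b"
    by (rule Ioo_exhaust[OF ab]) blast
  have mem: "c n \<in> {a..b}" "d n \<in> {a..b}" for n
    using cd(1-3)[of n] by auto
  have "(\<lambda>n. \<integral>x. indicator {c n<..<d n} x * v x \<partial>I) \<longlonglongrightarrow> (\<integral>x. v x \<partial>I)"
  proof (rule integral_dominated_convergence[where w="\<lambda>x. \<bar>v x\<bar>"])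
    show "AE x in I. (\<lambda>n. indicator {c n<..<d n} x * v x) \<longlonglongrightarrow> v x"
      by (intro AE_I2 tendsto_indicator_Ioo[OF cd(4,5)]) simp
    show "(\<lambda>x. indicator {c n<..<d n} x * v x) \<in> borel_measurable I" for n
      by (intro borel_measurable_times borel_measurable_I borel_measurable_integrable[OF v]) simp
  qed (use v in \<open>auto simp: indicator_def\<close>)
  moreover have "(\<integral>x. indicator {c n<..<d n} x * v x \<partial>I) = u (d n) - u (c n)" for n
    unfolding has_weak_deriv_ftc[OF w u cd(1,2,3), symmetric] integral_I
    using cd(1,3)[of n] by (intro Bochner_Integration.integral_cong) (auto simp: indicator_def)
  moreover have "(\<lambda>n. u (d n) - u (c n)) \<longlonglongrightarrow> u b - u a"
    using u cd mem ab by (intro tendsto_diff continuous_on_tendsto_compose[OF u]) auto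
  ultimately show ?thesis
    by (simp add: LIMSEQ_unique)
qed

text \<open>\<open>weak_deriv\<close> selects some weak derivative, with nothing said about its
  integrability. Uniqueness transfers the bounds from the witness in \<open>W1var\<close>.\<close>

lemma admissible_weak_deriv:
  assumes u: "u \<in> admissible a b p A B"
  defines "v \<equiv> weak_deriv a b u"
  shows "has_weak_deriv a b u v" "v \<in> borel_measurable I" "integrable I v"
    "(\<integral>x. v x \<partial>I) = B - A" "integrable I (\<lambda>x. \<bar>v x\<bar> powr p x)"
proof -
  from u have c: "continuous_on {a..b} u" and bv: "u a = A" "u b = B"
    by (auto simp: admissible_def)
  from u obtain v' where v': "v' \<in> Lvar I p" "has_weak_deriv a b u v'"
    by (auto simp: admissible_def W1var_def)
  show wd: "has_weak_deriv a b u v"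
    unfolding v_def weak_deriv_def by (rule someI[of "has_weak_deriv a b u", OF v'(2)])
  have eq: "AE x in I. v x = v' x"
    by (rule weak_deriv_unique[OF wd v'(2) c])
  show m [measurable]: "v \<in> borel_measurable I"
    using wd by (intro locally_integrable_measurable) (simp add: has_weak_deriv_def)
  have [measurable]: "v' \<in> borel_measurable I"
    using v' by (simp add: Lvar_def)
  show i: "integrable I v"
    using Lvar_integrable[OF v'(1)] eq by (subst integrable_cong_AE[where g=v']) auto
  have "AE x in I. \<bar>v x\<bar> powr p x = \<bar>v' x\<bar> powr p x"
    using eq by eventually_elim simp
  then show "integrable I (\<lambda>x. \<bar>v x\<bar> powr p x)"
    using Lvar_integrable_powr[OF v'(1)] by (subst integrable_cong_AE) (auto, measurable)
  show "(\<integral>x. v x \<partial>I) = B - A"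
    using has_weak_deriv_ftc_total[OF wd c i] bv by simp
qed

end

section \<open>Primitives as admissible functions\<close>

context exponent_interval begin

text \<open>The indicator keeps the domain of integration fixed, so that dominated convergence and
  Fubini apply directly.\<close>

definition primitive :: "(real \<Rightarrow> real) \<Rightarrow> real \<Rightarrow> real" where
  "primitive v x = (\<integral>y. indicator {..<x} y * v y \<partial>I)"

lemma integrable_indicator_mult:
  "integrable I v \<Longrightarrow> A \<in> sets borel \<Longrightarrow> integrable I (\<lambda>y. indicator A y * (v y :: real))"
  using integrable_mult_indicator[of A I v]
  by (simp add: Bochner_Integration.integrable_bound[where f=v] borel_measurable_I indicator_def
      borel_measurable_times borel_measurable_indicator' abs_mult)

lemma continuous_primitive:
  assumes v: "integrable I v"
  shows "continuous_on S (primitive v)"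
proof (rule continuous_on_sequentiallyI)
  fix x :: "nat \<Rightarrow> real" and l assume x: "x \<longlonglongrightarrow> l"
  show "(\<lambda>n. primitive v (x n)) \<longlonglongrightarrow> primitive v l"
    unfolding primitive_def
  proof (rule integral_dominated_convergence[where w="\<lambda>y. \<bar>v y\<bar>"])
    show "AE y in I. (\<lambda>n. indicator {..<x n} y * v y) \<longlonglongrightarrow> indicator {..<l} y * v y"
      using AE_I_neq[of l]
    proof eventually_elim
      case (elim y)
      have "\<forall>\<^sub>F n in sequentially. indicator {..<l} y * v y = indicator {..<x n} y * v y"
      proof (cases "y < l")
        case True
        show ?thesis
          by (rule eventually_mono[OF order_tendstoD(1)[OF x True]]) (use True in auto)
      next
        case False
        with elim have "l < y" by simp
        show ?thesis
          by (rule eventually_mono[OF order_tendstoD(2)[OF x \<open>l < y\<close>]]) (use \<open>l < y\<close> in auto)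
      qed
      then show ?case
        by (rule Lim_transform_eventually[OF tendsto_const])
    qed
    show "AE y in I. norm (indicator {..<x n} y * v y) \<le> \<bar>v y\<bar>" for n
      by (auto simp: indicator_def)
    show "(\<lambda>y. indicator {..<z} y * v y) \<in> borel_measurable I" for z
      by (rule borel_measurable_integrable[OF integrable_indicator_mult[OF v]]) simp
    then show "(\<lambda>y. indicator {..<x n} y * v y) \<in> borel_measurable I" for n .
  qed (use v in simp)
qed

lemma primitive_a: "primitive v a = 0"
proof -
  have "primitive v a = (\<integral>y. 0 \<partial>I)"
    unfolding primitive_def by (rule Bochner_Integration.integral_cong) auto
  then show ?thesis by simp
qed

lemma primitive_b: "primitive v b = (\<integral>y. v y \<partial>I)"
  unfolding primitive_def by (rule Bochner_Integration.integral_cong) auto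

lemma test_function_deriv:
  assumes "test_function a b \<phi>"
  shows "(\<phi> has_real_derivative deriv \<phi> x) (at x)" "isCont (deriv \<phi>) x"
    "\<phi> a = 0" "\<phi> b = 0"
proof -
  have d: "(deriv ^^ n) \<phi> differentiable (at x)" for n x
    using assms by (simp add: test_function_def)
  show "(\<phi> has_real_derivative deriv \<phi> x) (at x)"
    using d[of 0] by (simp add: DERIV_deriv_iff_real_differentiable)
  show "isCont (deriv \<phi>) x"
    using d[of 1] by (simp add: differentiable_imp_continuous_within)
  show "\<phi> a = 0" "\<phi> b = 0"
    using assms by (auto simp: test_function_def)
qed

lemma integral_test_function_deriv:
  assumes \<phi>: "test_function a b \<phi>" and y: "a \<le> y" "y \<le> b"
  shows "(\<integral>x. indicator {y<..} x * deriv \<phi> x \<partial>I) = - \<phi> y"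
proof -
  have [measurable]: "deriv \<phi> \<in> borel_measurable borel"
    by (intro borel_measurable_continuous_onI continuous_at_imp_continuous_on ballI
        test_function_deriv(2)[OF \<phi>])
  have "(\<integral>x. indicator {y<..} x * deriv \<phi> x \<partial>I) = (\<integral>x. indicator {a<..<b} x * (indicator {y<..} x * deriv \<phi> x) \<partial>lborel)"
    unfolding integral_I by (rule integral_completion) measurable
  also have "\<dots> = (\<integral>x. deriv \<phi> x * indicator {y..b} x \<partial>lborel)"
  proof (rule integral_cong_AE)
    show "AE x in lborel. indicator {a<..<b} x * (indicator {y<..} x * deriv \<phi> x) = deriv \<phi> x * indicator {y..b} x"
      using AE_lborel_singleton[of y] AE_lborel_singleton[of b]
      by eventually_elim (use y in \<open>auto simp: indicator_def\<close>)
  qed measurable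
  also have "\<dots> = \<phi> b - \<phi> y"
    by (rule integral_FTC_Icc_real) (use y test_function_deriv[OF \<phi>] in auto)
  finally show ?thesis
    using test_function_deriv(4)[OF \<phi>] by simp
qed

lemma integrable_continuous_I:
  assumes "continuous_on {a..b} f"
  shows "integrable I (f :: real \<Rightarrow> real)" "locally_integrable a b f"
proof -
  have i: "integrable lebesgue (\<lambda>x. indicator K x * f x)" if "compact K" "K \<subseteq> {a..b}" for K
  proof -
    have "integrable lborel (\<lambda>x. indicator K x *\<^sub>R f x)"
      by (rule borel_integrable_compact[OF that(1) continuous_on_subset[OF assms that(2)]])
    then show ?thesis
      by (subst integrable_completion) auto
  qed
  show "locally_integrable a b f"
    unfolding locally_integrable_def
  proof (intro allI impI, elim conjE)
    fix K assume K: "compact K" "K \<subseteq> {a<..<b}"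
    then have "K \<subseteq> {a..b}" by auto
    from i[OF K(1) this] show "integrable (lebesgue_on K) f"
      using K(1) by (subst integrable_restrict_space) (auto simp: borel_compact)
  qed
  have "integrable lebesgue (\<lambda>x. indicator {a<..<b} x *\<^sub>R (indicator {a..b} x * f x))"
    by (rule integrable_mult_indicator[OF _ i]) auto
  also have "(\<lambda>x. indicator {a<..<b} x *\<^sub>R (indicator {a..b} x * f x)) = (\<lambda>x. indicator {a<..<b} x * f x)"
    by (auto simp: indicator_def)
  finally show "integrable I f"
    by (simp add: integrable_I)
qed

lemma integrable_locally_integrable:
  assumes "integrable I v"
  shows "locally_integrable a b v"
  unfolding locally_integrable_def
proof (intro allI impI, elim conjE)
  fix K assume K: "compact K" "K \<subseteq> {a<..<b}"
  then have K': "K \<in> sets lebesgue" by (auto simp: borel_compact)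
  have "integrable lebesgue (\<lambda>x. indicator K x *\<^sub>R (indicator {a<..<b} x * v x))"
    using assms by (intro integrable_mult_indicator K') (simp only: integrable_I)
  also have "(\<lambda>x. indicator K x *\<^sub>R (indicator {a<..<b} x * v x)) = (\<lambda>x. indicator K x *\<^sub>R v x)"
    by (rule ext) (use K in \<open>auto simp: indicator_def\<close>)
  finally show "integrable (lebesgue_on K) v"
    using K' by (subst integrable_restrict_space) auto
qed

sublocale II: pair_sigma_finite I I
  by unfold_locales

text \<open>Fubini moves the inner integral onto the test function, where integrating its derivative
  from \<open>y\<close> to \<open>b\<close> gives \<open>- \<phi> y\<close>. The constant
  \<open>A\<close> drops out because \<open>\<phi>\<close> vanishes at both ends.\<close>

lemma has_weak_deriv_primitive:
  assumes v: "integrable I v"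
  shows "has_weak_deriv a b (\<lambda>x. A + primitive v x) v"
  unfolding has_weak_deriv_def
proof (intro conjI allI impI)
  have cont: "continuous_on {a..b} (\<lambda>x. A + primitive v x)"
    by (intro continuous_intros continuous_primitive v)
  then show "locally_integrable a b (\<lambda>x. A + primitive v x)"
    by (rule integrable_continuous_I)
  show "locally_integrable a b v"
    by (rule integrable_locally_integrable[OF v])
  fix \<phi> assume \<phi>: "test_function a b \<phi>"
  note d = test_function_deriv[OF \<phi>]
  have cd: "continuous_on {a..b} (deriv \<phi>)"
    by (intro continuous_at_imp_continuous_on ballI d)
  have di: "integrable I (deriv \<phi>)"
    by (rule integrable_continuous_I[OF cd])
  have [measurable]: "v \<in> borel_measurable I" "deriv \<phi> \<in> borel_measurable I"
    using v di by auto
  define H where "H = (\<lambda>x y. indicator {..<x} y * v y * deriv \<phi> x :: real)"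
  \<comment> \<open>The product without the indicator is integrable on the square and dominates
    \<open>H\<close>.\<close>
  have "integrable (I \<Otimes>\<^sub>M I) (\<lambda>(x, y). v y * deriv \<phi> x)"
  proof (rule II.Fubini_integrable)
    show "AE x in I. integrable I (\<lambda>y. case (x, y) of (x, y) \<Rightarrow> v y * deriv \<phi> x)"
      using v by simp
    show "integrable I (\<lambda>x. \<integral>y. norm (case (x, y) of (x, y) \<Rightarrow> v y * deriv \<phi> x) \<partial>I)"
      using v di by (simp add: abs_mult)
  qed measurable
  then have Hi: "integrable (I \<Otimes>\<^sub>M I) (\<lambda>(x, y). H x y)"
  proof (rule Bochner_Integration.integrable_bound)
    have [measurable]: "(\<lambda>x. x) \<in> borel_measurable I" by (rule measurable_ident_I)
    have "(\<lambda>(x, y). H x y) = (\<lambda>z. (if snd z < fst z then 1 else 0) * v (snd z) * deriv \<phi> (fst z))"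
      by (auto simp: H_def indicator_def)
    also have "\<dots> \<in> borel_measurable (I \<Otimes>\<^sub>M I)"
      by measurable
    finally show "(\<lambda>(x, y). H x y) \<in> borel_measurable (I \<Otimes>\<^sub>M I)" .
  qed (auto simp: H_def indicator_def)
  have "(\<integral>x. primitive v x * deriv \<phi> x \<partial>I) = (\<integral>x. \<integral>y. H x y \<partial>I \<partial>I)"
    by (simp add: primitive_def H_def)
  also have "\<dots> = (\<integral>y. \<integral>x. H x y \<partial>I \<partial>I)"
    by (rule II.Fubini_integral[OF Hi, symmetric])
  also have "\<dots> = (\<integral>y. - (v y * \<phi> y) \<partial>I)"
  proof (rule Bochner_Integration.integral_cong)
    fix y assume y: "y \<in> space I"
    have "(\<lambda>x. H x y) = (\<lambda>x. v y * (indicator {y<..} x * deriv \<phi> x))"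
      by (auto simp: H_def indicator_def)
    then show "(\<integral>x. H x y \<partial>I) = - (v y * \<phi> y)"
      using integral_test_function_deriv[OF \<phi>, of y] y by simp
  qed simp
  finally have P: "(\<integral>x. primitive v x * deriv \<phi> x \<partial>I) = - (\<integral>y. v y * \<phi> y \<partial>I)"
    by simp
  have "(\<integral>x. deriv \<phi> x \<partial>I) = (\<integral>x. indicator {a<..} x * deriv \<phi> x \<partial>I)"
    by (rule Bochner_Integration.integral_cong) auto
  then have Z: "(\<integral>x. deriv \<phi> x \<partial>I) = 0"
    using integral_test_function_deriv[OF \<phi>, of a] ab d by simp
  have "integrable I (\<lambda>x. primitive v x * deriv \<phi> x)"
    by (intro integrable_continuous_I continuous_intros continuous_primitive v cd)
  then have "(\<integral>x. (A + primitive v x) * deriv \<phi> x \<partial>I)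
      = A * (\<integral>x. deriv \<phi> x \<partial>I) + (\<integral>x. primitive v x * deriv \<phi> x \<partial>I)"
    using di by (simp add: distrib_right)
  with P Z show "(\<integral>x. (A + primitive v x) * deriv \<phi> x \<partial>I) = - (\<integral>x. v x * \<phi> x \<partial>I)"
    by simp
qed

lemma primitive_admissible:
  assumes v: "v \<in> borel_measurable I" "AE x in I. \<bar>v x\<bar> \<le> B"
  shows "(\<lambda>x. A + primitive v x) \<in> admissible a b p A (A + (\<integral>x. v x \<partial>I))"
proof -
  have vi: "integrable I v" by (rule integrable_bounded_I[OF v])
  have cont: "continuous_on {a..b} (\<lambda>x. A + primitive v x)"
    by (intro continuous_intros continuous_primitive vi)
  have "bounded ((\<lambda>x. A + primitive v x) ` {a..b})"
    using compact_continuous_image[OF cont] compact_imp_bounded by blast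
  then obtain B' where "\<forall>y\<in>(\<lambda>x. A + primitive v x) ` {a..b}. norm y \<le> B'"
    by (auto simp: bounded_iff)
  then have "AE x in I. \<bar>A + primitive v x\<bar> \<le> B'"
    by (intro AE_I2) auto
  then have "(\<lambda>x. A + primitive v x) \<in> Lvar I p"
    by (rule Lvar_bounded[OF borel_measurable_integrable[OF integrable_continuous_I(1)[OF cont]]])
  moreover have "v \<in> Lvar I p"
    by (rule Lvar_bounded[OF v])
  ultimately show ?thesis
    using has_weak_deriv_primitive[OF vi, of A] cont
    by (auto simp: admissible_def W1var_def primitive_a primitive_b)
qed

end

section \<open>The Dirichlet-to-Neumann map\<close>

text \<open>For positive \<open>r\<close> write the power as \<open>r * exp ((p - 1) * ln r)\<close>
  and use \<open>1 + x < exp x\<close> at a nonzero argument together with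
  \<open>r - 1 \<le> r * ln r\<close>. For other \<open>r\<close> the left side is negative.
  Strictness is what later identifies the minimizer.\<close>

lemma powr_gt_tangent_1:
  fixes r p :: real
  assumes p: "1 < p" and r: "r \<noteq> 1"
  shows "1 + p * (r - 1) < \<bar>r\<bar> powr p"
proof (cases "0 < r")
  case True
  have "(p - 1) * ln r \<noteq> 0" using True r p by simp
  then have e: "1 + (p - 1) * ln r < exp ((p - 1) * ln r)"
    using ln_le_minus_one[of "exp ((p - 1) * ln r)"] ln_eq_minus_one[of "exp ((p - 1) * ln r)"]
    by fastforce
  have "r - 1 \<le> r * ln r"
    using ln_le_minus_one[of "1 / r"] True by (simp add: ln_div field_simps)
  then have "(p - 1) * (r - 1) \<le> (p - 1) * (r * ln r)"
    using p by (intro mult_left_mono) auto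
  then have "1 + p * (r - 1) \<le> r * (1 + (p - 1) * ln r)"
    by (simp add: algebra_simps)
  also have "\<dots> < r * exp ((p - 1) * ln r)"
    using e True by simp
  also have "\<dots> = r powr 1 * r powr (p - 1)"
    using True by (simp add: powr_def)
  also have "\<dots> = \<bar>r\<bar> powr p"
    using True powr_add[of r 1 "p - 1"] by simp
  finally show ?thesis .
next
  case False
  then have "p * (r - 1) \<le> p * (-1)" using p by (intro mult_left_mono) auto
  then have "1 + p * (r - 1) < 0" using p by linarith
  also have "0 \<le> \<bar>r\<bar> powr p" by simp
  finally show ?thesis .
qed

text \<open>Homogeneity reduces the tangent at \<open>V\<close> to the one at 1: take
  \<open>r = v / V\<close> and multiply by \<open>V powr p\<close>.\<close>

lemma powr_tangent:
  fixes v V p :: real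
  assumes p: "1 < p" and V: "0 < V" and v: "v \<noteq> V"
  shows "V powr p / p + V powr (p - 1) * (v - V) < \<bar>v\<bar> powr p / p"
proof -
  have "v / V \<noteq> 1" using V v by simp
  from powr_gt_tangent_1[OF p this]
  have "V powr p * (1 + p * (v / V - 1)) < V powr p * \<bar>v / V\<bar> powr p"
    using V by simp
  also have "V powr p * \<bar>v / V\<bar> powr p = \<bar>v\<bar> powr p"
    using V by (simp add: powr_divide abs_divide)
  also have "V powr p * (1 + p * (v / V - 1)) = p * (V powr p / p + V powr (p - 1) * (v - V))"
    using V p by (simp add: powr_diff field_simps)
  finally show ?thesis
    using p by (simp add: field_simps)
qed

text \<open>The power is monotone in each argument, in a direction that depends on the base relative
  to 1 and on the sign of the exponent. Hence its extremes over a rectangle are attained at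
  corners.\<close>

lemma powr_bounds:
  fixes c C l u y r :: real
  assumes "0 < c" "c \<le> y" "y \<le> C" "l \<le> r" "r \<le> u"
  shows "min (min (c powr l) (c powr u)) (min (C powr l) (C powr u)) \<le> y powr r"
    "y powr r \<le> max (max (c powr l) (c powr u)) (max (C powr l) (C powr u))"
proof -
  have y: "y powr r \<le> max (y powr l) (y powr u)" "min (y powr l) (y powr u) \<le> y powr r"
    using assms powr_mono[of r u y] powr_mono[of l r y] powr_mono'[of r u y] powr_mono'[of l r y]
    by (cases "1 \<le> y"; auto simp: le_max_iff_disj min_le_iff_disj)+
  have m: "y powr t \<le> max (c powr t) (C powr t) \<and> min (c powr t) (C powr t) \<le> y powr t" for t
    using assms powr_mono2[of t c y] powr_mono2[of t y C] powr_mono2'[of t c y] powr_mono2'[of t y C]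
    by (cases "0 \<le> t"; auto simp: le_max_iff_disj min_le_iff_disj)
  show "min (min (c powr l) (c powr u)) (min (C powr l) (C powr u)) \<le> y powr r"
    "y powr r \<le> max (max (c powr l) (c powr u)) (max (C powr l) (C powr u))"
    using y m[of l] m[of u] by linarith+
qed

section \<open>The solution of constant flux and its Dirichlet-to-Neumann value\<close>

context exponent_interval begin

definition rate :: "real \<Rightarrow> real" where "rate x = 1 / (p x - 1)"

lemma rate_measurable [measurable]: "rate \<in> borel_measurable I"
  unfolding rate_def[abs_def] by measurable

text \<open>The slope of the solution with flux 1. The exponent is spelled as in
  \<open>nonlinear_proj\<close>, so that the projected function is literally this one.\<close>

definition resistance :: "(real \<Rightarrow> real) \<Rightarrow> real \<Rightarrow> real" where
  "resistance \<gamma> x = \<gamma> x powr (- 1 / (p x - 1))"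

definition flux_drop :: "(real \<Rightarrow> real) \<Rightarrow> real \<Rightarrow> real" where
  "flux_drop \<gamma> k = (\<integral>x. k powr rate x * resistance \<gamma> x \<partial>I)"

lemma rate_bounds: "AE x in I. 1 / (pp - 1) \<le> rate x \<and> rate x \<le> 1 / (pm - 1)"
  using p_AE
proof eventually_elim
  case (elim x)
  then show ?case using pm pm_less_pp
    by (auto simp: rate_def intro!: divide_left_mono mult_pos_pos)
qed

lemma bounded_powr:
  assumes f [measurable]: "f \<in> borel_measurable I" and fb: "AE x in I. c \<le> f x \<and> f x \<le> C" and c: "0 < c"
    and g [measurable]: "g \<in> borel_measurable I" and gb: "AE x in I. l \<le> g x \<and> g x \<le> (u :: real)"
  obtains c' C' where "0 < c'" "AE x in I. c' \<le> f x powr g x \<and> f x powr g x \<le> C'"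
proof
  \<comment> \<open>The corner values at \<open>C\<close> are positive only if \<open>C\<close> is;
    \<open>c \<le> C\<close> follows from the pointwise bounds because the interval is not a null
    set.\<close>
  have "AE x in I. c \<le> C" using fb by eventually_elim auto
  then have "c \<le> C" using ae_filter_I by simp
  with c show "0 < min (min (c powr l) (c powr u)) (min (C powr l) (C powr u))" by auto
  show "AE x in I. min (min (c powr l) (c powr u)) (min (C powr l) (C powr u)) \<le> f x powr g x \<and>
     f x powr g x \<le> max (max (c powr l) (c powr u)) (max (C powr l) (C powr u))"
    using fb gb by eventually_elim (use c powr_bounds in blast)
qed

lemma resistance_eq_powr_rate: "resistance \<gamma> x = \<gamma> x powr (- rate x)"
  by (simp add: resistance_def rate_def)

lemma resistance_bounds:
  assumes \<gamma>: "\<gamma> \<in> Linf_plus I"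
  obtains c C where "0 < c" "AE x in I. c \<le> resistance \<gamma> x \<and> resistance \<gamma> x \<le> C"
    "resistance \<gamma> \<in> borel_measurable I"
proof -
  obtain c C where c: "0 < c" and m [measurable]: "\<gamma> \<in> borel_measurable I" and b: "AE x in I. c \<le> \<gamma> x \<and> \<gamma> x \<le> C"
    by (rule Linf_plus_bounds[OF \<gamma>])
  have sb: "AE x in I. - (1 / (pm - 1)) \<le> - rate x \<and> - rate x \<le> - (1 / (pp - 1))"
    using rate_bounds by eventually_elim auto
  have sm: "(\<lambda>x. - rate x) \<in> borel_measurable I" by measurable
  obtain c' C' where "0 < c'" "AE x in I. c' \<le> \<gamma> x powr (- rate x) \<and> \<gamma> x powr (- rate x) \<le> C'"
    by (rule bounded_powr[OF m b c sm sb])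
  moreover have "resistance \<gamma> \<in> borel_measurable I"
    unfolding resistance_eq_powr_rate[abs_def] by measurable
  ultimately show thesis
    using that by (simp add: resistance_eq_powr_rate)
qed

lemma powr_rate_resistance_bounds:
  assumes \<gamma>: "\<gamma> \<in> Linf_plus I" and k: "0 < k"
  obtains c C where "0 < c" "AE x in I. c \<le> k powr rate x * resistance \<gamma> x \<and> k powr rate x * resistance \<gamma> x \<le> C"
    "(\<lambda>x. k powr rate x * resistance \<gamma> x) \<in> borel_measurable I"
proof -
  obtain c C where c: "0 < c" and b: "AE x in I. c \<le> resistance \<gamma> x \<and> resistance \<gamma> x \<le> C"
    and m [measurable]: "resistance \<gamma> \<in> borel_measurable I"
    by (rule resistance_bounds[OF \<gamma>])
  obtain c' C' where c': "0 < c'" and b': "AE x in I. c' \<le> k powr rate x \<and> k powr rate x \<le> C'"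
    by (rule bounded_powr[of "\<lambda>_. k" k k rate, OF _ _ k rate_measurable rate_bounds]) auto
  have "AE x in I. c' * c \<le> k powr rate x * resistance \<gamma> x \<and> k powr rate x * resistance \<gamma> x \<le> C' * C"
    using b b' by eventually_elim (use c c' in \<open>auto intro!: mult_mono\<close>)
  moreover have "(\<lambda>x. k powr rate x * resistance \<gamma> x) \<in> borel_measurable I" by measurable
  ultimately show thesis using c c' that[of "c' * c" "C' * C"] by simp
qed

text \<open>\<open>flux_drop \<gamma> k\<close> is the boundary difference of the solution with flux \<open>k\<close>.  That every
  minimizer has this flux follows by integrating the strict tangent inequality for
  \<open>v \<mapsto> |v| powr p\<close> at the candidate derivative: its linear term integrates to the same value for all
  admissible functions.\<close>

lemma DN_map_flux:
  assumes \<gamma>: "\<gamma> \<in> Linf_plus I" and k: "0 < k"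
  shows "DN_map a b p \<gamma> (A, A + flux_drop \<gamma> k) = k * flux_drop \<gamma> k"
proof -
  define V where "V = (\<lambda>x. k powr rate x * resistance \<gamma> x)"
  define m where "m = flux_drop \<gamma> k"
  obtain c C where c: "0 < c" and Vb: "AE x in I. c \<le> V x \<and> V x \<le> C"
    and Vm [measurable]: "V \<in> borel_measurable I"
    unfolding V_def by (rule powr_rate_resistance_bounds[OF \<gamma> k])
  obtain c' C' where c': "0 < c'" and [measurable]: "\<gamma> \<in> borel_measurable I"
    and \<gamma>b: "AE x in I. c' \<le> \<gamma> x \<and> \<gamma> x \<le> C'"
    by (rule Linf_plus_bounds[OF \<gamma>])
  have mV: "m = (\<integral>x. V x \<partial>I)" by (simp add: m_def flux_drop_def V_def)
  have "AE x in I. \<bar>V x\<bar> \<le> C" using Vb by eventually_elim (use c in auto)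
  note VB = this
  have Vi: "integrable I V" by (rule integrable_bounded_I[OF Vm VB])
  \<comment> \<open>The slope \<open>V\<close> was obtained by solving exactly this
    equation.\<close>
  have flux: "AE x in I. \<gamma> x * V x powr (p x - 1) = k"
    using p_AE \<gamma>b
  proof eventually_elim
    case (elim x)
    then have "p x - 1 > 0" "\<gamma> x > 0" using pm c' by auto
    then have "V x powr (p x - 1) = k / \<gamma> x"
      using k by (simp add: V_def resistance_eq_powr_rate rate_def powr_mult powr_divide powr_powr powr_minus_divide)
    with \<open>\<gamma> x > 0\<close> show ?case by simp
  qed
  define U where "U = (\<lambda>x. A + primitive V x)"
  have U: "U \<in> admissible a b p A (A + m)"
    unfolding U_def mV by (rule primitive_admissible[OF Vm VB])
  have WU: "AE x in I. weak_deriv a b U x = V x"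
  proof (rule weak_deriv_unique)
    show "has_weak_deriv a b U (weak_deriv a b U)"
      by (rule admissible_weak_deriv[OF U])
    show "has_weak_deriv a b U V"
      unfolding U_def by (rule has_weak_deriv_primitive[OF Vi])
    show "continuous_on {a..b} U"
      using U by (simp add: admissible_def)
  qed
  \<comment> \<open>The pointwise gap in the tangent inequality. Its linear term integrates to 0,
    since the derivative of \<open>w\<close> and \<open>V\<close> both have integral
    \<open>m\<close>; what remains is the difference of energies.\<close>
  define D where "D = (\<lambda>w x. \<gamma> x / p x * \<bar>weak_deriv a b w x\<bar> powr p x
    - \<gamma> x / p x * \<bar>weak_deriv a b U x\<bar> powr p x - k * (weak_deriv a b w x - V x))"
  have e_int: "integrable I (\<lambda>x. \<gamma> x / p x * \<bar>weak_deriv a b w x\<bar> powr p x)"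
    if w: "w \<in> admissible a b p A (A + m)" for w
  proof (rule Bochner_Integration.integrable_bound)
    have [measurable]: "weak_deriv a b w \<in> borel_measurable I"
      by (rule admissible_weak_deriv[OF w])
    show "integrable I (\<lambda>x. C' * \<bar>weak_deriv a b w x\<bar> powr p x)"
      using admissible_weak_deriv(5)[OF w] by simp
    show "AE x in I. norm (\<gamma> x / p x * \<bar>weak_deriv a b w x\<bar> powr p x) \<le> norm (C' * \<bar>weak_deriv a b w x\<bar> powr p x)"
      using p_AE \<gamma>b
    proof eventually_elim
      case (elim x)
      have "\<gamma> x / p x \<le> \<gamma> x / 1"
        using elim pm c' by (intro divide_left_mono) auto
      also have "\<dots> \<le> C'" using elim by simp
      finally have "\<bar>\<gamma> x / p x\<bar> \<le> \<bar>C'\<bar>"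
        using elim pm c' by auto
      then show ?case by (simp only: real_norm_def abs_mult mult_right_mono abs_ge_zero)
    qed
    show "(\<lambda>x. \<gamma> x / p x * \<bar>weak_deriv a b w x\<bar> powr p x) \<in> borel_measurable I" by measurable
  qed
  have D_int: "integrable I (D w)" and D_eq: "(\<integral>x. D w x \<partial>I) = energy a b p \<gamma> w - energy a b p \<gamma> U"
    if w: "w \<in> admissible a b p A (A + m)" for w
    using e_int[OF w] e_int[OF U] admissible_weak_deriv(3,4)[OF w] Vi
    by (simp_all add: D_def energy_def mV)
  have D_pos: "AE x in I. 0 \<le> D w x \<and> (D w x = 0 \<longrightarrow> weak_deriv a b w x = V x)" for w
    using p_AE \<gamma>b Vb flux WU
  proof eventually_elim
    case (elim x)
    have px: "1 < p x" and Vx: "0 < V x" and gx: "0 < \<gamma> x" using elim pm c c' by auto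
    show ?case
    proof (cases "weak_deriv a b w x = V x")
      case True
      then show ?thesis using elim by (simp add: D_def)
    next
      case False
      have "\<gamma> x * (V x powr p x / p x + V x powr (p x - 1) * (weak_deriv a b w x - V x))
          < \<gamma> x * (\<bar>weak_deriv a b w x\<bar> powr p x / p x)"
        by (rule mult_strict_left_mono[OF powr_tangent[OF px Vx False] gx])
      moreover have "\<gamma> x * (V x powr p x / p x + V x powr (p x - 1) * (weak_deriv a b w x - V x))
         = \<gamma> x / p x * V x powr p x + (\<gamma> x * V x powr (p x - 1)) * (weak_deriv a b w x - V x)"
        by (simp add: algebra_simps)
      ultimately have "0 < D w x"
        unfolding D_def elim(4,5) using Vx by simp
      then show ?thesis by simp
    qed
  qed
  \<comment> \<open>The explicit candidate is itself a minimizer, so the choice in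
    \<open>dirichlet_solution\<close> has a witness without any compactness argument.\<close>
  have min_U: "is_minimizer a b p \<gamma> A (A + m) U"
    unfolding is_minimizer_def
  proof (intro conjI ballI U)
    fix w assume w: "w \<in> admissible a b p A (A + m)"
    have "0 \<le> (\<integral>x. D w x \<partial>I)"
      by (rule integral_nonneg_AE) (use D_pos[of w] in \<open>auto elim: eventually_mono\<close>)
    with D_eq[OF w] show "energy a b p \<gamma> U \<le> energy a b p \<gamma> w" by simp
  qed
  define W where "W = dirichlet_solution a b p \<gamma> A (A + m)"
  have "is_minimizer a b p \<gamma> A (A + m) W"
    unfolding W_def dirichlet_solution_def by (rule someI[of "is_minimizer a b p \<gamma> A (A + m)", OF min_U])
  then have W: "W \<in> admissible a b p A (A + m)" and "energy a b p \<gamma> W \<le> energy a b p \<gamma> U"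
    using U by (auto simp: is_minimizer_def)
  \<comment> \<open>For the chosen minimizer the nonnegative gap has integral 0, so its derivative
    equals \<open>V\<close> almost everywhere. \<open>DN_map\<close> sees nothing but that
    derivative.\<close>
  have pos: "AE x in I. 0 \<le> D W x" using D_pos[of W] by eventually_elim simp
  then have "0 \<le> (\<integral>x. D W x \<partial>I)" by (rule integral_nonneg_AE)
  with D_eq[OF W] \<open>energy a b p \<gamma> W \<le> energy a b p \<gamma> U\<close> have "(\<integral>x. D W x \<partial>I) = 0" by simp
  then have "AE x in I. D W x = 0"
    using integral_nonneg_eq_0_iff_AE[OF D_int[OF W] pos] by simp
  with D_pos[of W] have WV: "AE x in I. weak_deriv a b W x = V x"
    by eventually_elim simp
  have [measurable]: "weak_deriv a b W \<in> borel_measurable I"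
    by (rule admissible_weak_deriv[OF W])
  have "DN_map a b p \<gamma> (A, A + m) = (\<integral>x. \<gamma> x * \<bar>weak_deriv a b W x\<bar> powr p x \<partial>I)"
    by (simp add: DN_map_def W_def)
  also have "\<dots> = (\<integral>x. k * V x \<partial>I)"
  proof (rule integral_cong_AE)
    show "AE x in I. \<gamma> x * \<bar>weak_deriv a b W x\<bar> powr p x = k * V x"
      using WV flux Vb
    proof eventually_elim
      case (elim x)
      have "\<bar>V x\<bar> powr p x = V x powr (p x - 1) * V x"
        using elim c by (simp add: powr_diff)
      then show ?case unfolding elim(1) using elim(2) by (simp add: mult.assoc[symmetric])
    qed
  qed measurable
  finally show ?thesis by (simp add: mV[symmetric] m_def[symmetric])
qed

end

section \<open>Exponential moments\<close>

text \<open>A nonzero coefficient of positive index would make the origin an isolated zero of the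
  sum. The constant coefficient is read off at 0.\<close>

lemma powser_coeffs_zero:
  fixes c :: "nat \<Rightarrow> real"
  assumes "0 < \<delta>" and s: "\<And>x. \<bar>x\<bar> < \<delta> \<Longrightarrow> (\<lambda>n. c n * x ^ n) sums 0"
  shows "c n = 0"
proof (cases "n = 0")
  case True
  then show ?thesis using s[of 0] \<open>0 < \<delta>\<close> by simp
next
  case False
  show ?thesis
  proof (rule ccontr)
    assume "c n \<noteq> 0"
    show False
    proof (rule powser_0_nonzero[of \<delta> 0 c "\<lambda>_. 0" n])
      fix r :: real assume "0 < r" "\<And>z::real. z \<in> cball 0 r - {0} \<Longrightarrow> (0::real) \<noteq> 0"
      from this(2)[of r] \<open>0 < r\<close> show False by simp
    qed (use False s \<open>0 < \<delta>\<close> \<open>c n \<noteq> 0\<close> in auto)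
  qed
qed

context finite_measure begin

text \<open>Termwise integration, dominated by an exponential series because \<open>s\<close> and
  \<open>f\<close> are bounded. The field of \<open>z\<close> is left open: the real instance meets
  the data, the complex one gives characteristic functions, and both have the same real
  coefficients.\<close>

lemma exp_integral_sums:
  fixes s f :: "'a \<Rightarrow> real" and z :: "'b :: {real_normed_field, banach, second_countable_topology}"
  assumes [measurable]: "s \<in> borel_measurable M" "f \<in> borel_measurable M"
    and S: "AE x in M. \<bar>s x\<bar> \<le> S" and C: "AE x in M. \<bar>f x\<bar> \<le> C"
  shows "(\<lambda>n. of_real ((\<integral>x. s x ^ n * f x \<partial>M) / fact n) * z ^ n)
    sums (\<integral>x. exp (z * of_real (s x)) * of_real (f x) \<partial>M)"
proof -
  let ?t = "\<lambda>n x. of_real (s x ^ n * f x) * (z ^ n / fact n)"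
  have bd: "AE x in M. norm (?t n x) \<le> (S * norm z) ^ n / fact n * C" for n
    using S C
  proof eventually_elim
    case (elim x)
    have "norm (?t n x) = \<bar>s x\<bar> ^ n * norm z ^ n / fact n * \<bar>f x\<bar>"
      by (simp add: norm_mult norm_divide norm_power abs_mult power_abs)
    also have "\<dots> \<le> S ^ n * norm z ^ n / fact n * C"
      using elim by (intro mult_mono divide_right_mono power_mono) auto
    finally show ?case by (simp add: power_mult_distrib)
  qed
  have [measurable]: "(\<lambda>x. of_real (g x) :: 'b) \<in> borel_measurable M" if "g \<in> borel_measurable M" for g
    using borel_measurable_continuous_onI[of "of_real :: real \<Rightarrow> 'b"] that
    by (auto intro: measurable_compose continuous_on_of_real)
  have sm: "(\<lambda>x. s x ^ n * f x) \<in> borel_measurable M" for n by measurable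
  have int: "integrable M (?t n)" for n
    by (rule integrable_const_bound[OF bd]) (use sm in measurable)
  have expS: "summable (\<lambda>n. (S * norm z) ^ n / fact n * C)"
    using summable_exp[of "S * norm z"]
    by (intro summable_mult2) (simp add: field_simps)
  have sums: "(\<lambda>n. integral\<^sup>L M (?t n)) sums (\<integral>x. (\<Sum>n. ?t n x) \<partial>M)"
  proof (rule sums_integral[OF int])
    have "AE x in M. \<forall>n. norm (?t n x) \<le> (S * norm z) ^ n / fact n * C"
      using bd by (simp add: AE_all_countable)
    then show "AE x in M. summable (\<lambda>n. norm (?t n x))"
      by eventually_elim (auto intro: summable_comparison_test[OF _ expS])
    show "summable (\<lambda>n. \<integral>x. norm (?t n x) \<partial>M)"
    proof (rule summable_comparison_test)
      show "summable (\<lambda>n. (S * norm z) ^ n / fact n * C * measure M (space M))"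
        by (intro summable_mult2 expS)
      show "\<exists>N. \<forall>n\<ge>N. norm (\<integral>x. norm (?t n x) \<partial>M) \<le> (S * norm z) ^ n / fact n * C * measure M (space M)"
      proof (intro exI allI impI)
        fix n
        have "(\<integral>x. norm (?t n x) \<partial>M) \<le> (\<integral>x. (S * norm z) ^ n / fact n * C \<partial>M)"
          by (rule integral_mono_AE) (use int bd in auto)
        then show "norm (\<integral>x. norm (?t n x) \<partial>M) \<le> (S * norm z) ^ n / fact n * C * measure M (space M)"
          by (simp add: mult_ac)
      qed
    qed
  qed
  have coeff: "integral\<^sup>L M (?t n) = of_real ((\<integral>x. s x ^ n * f x \<partial>M) / fact n) * z ^ n" for n
  proof -
    have "AE x in M. norm (s x ^ n * f x) \<le> S ^ n * C"
      using S C by eventually_elim (auto simp: abs_mult power_abs intro!: mult_mono power_mono)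
    then have "integrable M (\<lambda>x. s x ^ n * f x)"
      by (rule integrable_const_bound) (rule sm)
    then have "(\<integral>x. of_real (s x ^ n * f x) \<partial>M) = (of_real (\<integral>x. s x ^ n * f x \<partial>M) :: 'b)"
      by (rule integral_bounded_linear[OF bounded_linear_of_real])
    then show ?thesis
      by (simp only: integral_mult_left_zero of_real_divide) simp
  qed
  have limit: "(\<Sum>n. ?t n x) = exp (z * of_real (s x)) * of_real (f x)" for x
  proof -
    have "(\<lambda>n. (z * of_real (s x)) ^ n /\<^sub>R fact n * of_real (f x)) sums (exp (z * of_real (s x)) * of_real (f x))"
      by (intro sums_mult2 exp_converges)
    also have "(\<lambda>n. (z * of_real (s x)) ^ n /\<^sub>R fact n * of_real (f x)) = (\<lambda>n. ?t n x)"
      by (auto simp: scaleR_conv_of_real power_mult_distrib field_simps)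
    finally show ?thesis by (simp add: sums_iff)
  qed
  show ?thesis
    using sums by (simp only: coeff limit)
qed

text \<open>Agreement near 0 on the real line fixes all moments of \<open>s\<close> under the two
  weights; the moments fix the characteristic functions and thereby the pushforward
  measures.\<close>

lemma exp_moments_unique:
  fixes s f g :: "'a \<Rightarrow> real"
  assumes s [measurable]: "s \<in> borel_measurable M" and S: "AE x in M. \<bar>s x\<bar> \<le> S"
    and f [measurable]: "f \<in> borel_measurable M" and fb: "AE x in M. 0 \<le> f x \<and> f x \<le> C"
    and g [measurable]: "g \<in> borel_measurable M" and gb: "AE x in M. 0 \<le> g x \<and> g x \<le> C'"
    and pos: "0 < (\<integral>x. f x \<partial>M)"
    and \<delta>: "0 < \<delta>" and eq: "\<And>\<tau>. \<bar>\<tau>\<bar> < \<delta> \<Longrightarrow> (\<integral>x. exp (\<tau> * s x) * f x \<partial>M) = (\<integral>x. exp (\<tau> * s x) * g x \<partial>M)"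
    and A [measurable]: "A \<in> sets borel"
  shows "(\<integral>x. indicator A (s x) * f x \<partial>M) = (\<integral>x. indicator A (s x) * g x \<partial>M)"
proof -
  have fb': "AE x in M. \<bar>f x\<bar> \<le> C" and gb': "AE x in M. \<bar>g x\<bar> \<le> C'"
    using fb gb by (auto elim: eventually_mono)
  note F = exp_integral_sums[OF s f S fb'] and G = exp_integral_sums[OF s g S gb']
  define cf where "cf n = (\<integral>x. s x ^ n * f x \<partial>M) / fact n" for n
  define cg where "cg n = (\<integral>x. s x ^ n * g x \<partial>M) / fact n" for n
  have "cf n - cg n = 0" for n
  proof (rule powser_coeffs_zero[OF \<delta>])
    fix x :: real assume "\<bar>x\<bar> < \<delta>"
    from sums_diff[OF F[of x] G[of x]] eq[OF this]
    show "(\<lambda>n. (cf n - cg n) * x ^ n) sums 0"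
      by (simp add: cf_def cg_def left_diff_distrib)
  qed
  then have mom: "cf = cg" by (intro ext) (metis eq_iff_diff_eq_0)
  \<comment> \<open>The passage to complex arguments: the same coefficients are summed at
    \<open>z\<close>.\<close>
  have ch: "(\<integral>x. exp (z * of_real (s x)) * of_real (f x) \<partial>M) = (\<integral>x. exp (z * of_real (s x)) * of_real (g x) \<partial>M)"
    for z :: complex
    using F[of z] G[of z] mom unfolding cf_def cg_def fun_eq_iff by (metis (no_types, lifting) sums_cong sums_unique2)
  \<comment> \<open>Levy's theorem is about probability distributions, so both weights are divided
    by their mass. The masses agree by the hypothesis at \<open>\<tau> = 0\<close>.\<close>
  define m where "m = (\<integral>x. f x \<partial>M)"
  have m: "0 < m" "m = (\<integral>x. g x \<partial>M)"
    using pos eq[of 0] \<delta> by (auto simp: m_def)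
  define D where "D h = distr (density M (\<lambda>x. ennreal (h x / m))) borel s" for h
  have D_int: "(\<integral>y. h y \<partial>D q) = (\<integral>x. (q x / m) *\<^sub>R h (s x) \<partial>M)"
    if [measurable]: "q \<in> borel_measurable M" and q: "AE x in M. 0 \<le> q x" and [measurable]: "h \<in> borel_measurable borel"
    for q and h :: "real \<Rightarrow> 'b :: {banach, second_countable_topology}"
    unfolding D_def using q m
    by (subst integral_distr) (auto intro!: integral_density elim: eventually_mono)
  have D_dist: "real_distribution (D q)"
    if [measurable]: "q \<in> borel_measurable M" and q: "AE x in M. 0 \<le> q x \<and> q x \<le> Q" and qm: "m = (\<integral>x. q x \<partial>M)" for q Q
  proof -
    have qi: "integrable M q"
      by (rule integrable_const_bound[where B=Q]) (use q in \<open>auto elim: eventually_mono\<close>)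
    have "emeasure (density M (\<lambda>x. ennreal (q x / m))) (space M) = (\<integral>\<^sup>+x. ennreal (q x / m) \<partial>M)"
      by (subst emeasure_density) (auto intro!: nn_integral_cong)
    also have "\<dots> = ennreal (\<integral>x. q x / m \<partial>M)"
      by (rule nn_integral_eq_integral) (use qi q m in \<open>auto elim: eventually_mono\<close>)
    also have "\<dots> = 1" using qm m by simp
    finally have "prob_space (density M (\<lambda>x. ennreal (q x / m)))"
      by (intro prob_spaceI) simp
    then have "prob_space (D q)"
      unfolding D_def by (rule prob_space.prob_space_distr) simp
    then show ?thesis
      by (intro real_distribution.intro real_distribution_axioms.intro) (simp_all add: D_def)
  qed
  have f0: "AE x in M. 0 \<le> f x" and g0: "AE x in M. 0 \<le> g x"
    using fb gb by (auto elim: eventually_mono)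
  have char: "char (D q) t = (\<integral>x. exp ((\<i> * of_real t) * of_real (s x)) * of_real (q x) \<partial>M) / of_real m"
    if "q \<in> borel_measurable M" "AE x in M. 0 \<le> q x" for q t
    unfolding char_def
    by (subst D_int[OF that]) (auto simp: scaleR_conv_of_real mult_ac simp flip: integral_divide_zero)
  have "D f = D g"
  proof (rule Levy_uniqueness[OF D_dist[OF f fb] D_dist[OF g gb]])
    show "char (D f) = char (D g)"
      by (rule ext) (simp add: char[OF f f0] char[OF g g0] ch)
  qed (use m in \<open>auto simp: m_def\<close>)
  then have "(\<integral>x. (f x / m) *\<^sub>R indicator A (s x) \<partial>M) = (\<integral>x. (g x / m) *\<^sub>R (indicator A (s x) :: real) \<partial>M)"
    by (simp only: D_int[OF f f0, symmetric] D_int[OF g g0, symmetric] A borel_measurable_indicator)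
  then have "(\<integral>x. indicator A (s x) * f x \<partial>M) / m = (\<integral>x. indicator A (s x) * g x \<partial>M) / m"
    unfolding integral_divide_zero[symmetric] by (simp add: mult.commute)
  with m show ?thesis by simp
qed

text \<open>The integral is the sum of an everywhere convergent power series.\<close>

lemma continuous_exp_integral:
  fixes s f :: "'a \<Rightarrow> real"
  assumes "s \<in> borel_measurable M" "f \<in> borel_measurable M"
    and "AE x in M. \<bar>s x\<bar> \<le> S" "AE x in M. \<bar>f x\<bar> \<le> C"
  shows "isCont (\<lambda>\<tau>. \<integral>x. exp (\<tau> * s x) * f x \<partial>M) \<tau>"
proof -
  note F = exp_integral_sums[OF assms, where 'b=real, simplified]
  have "isCont (\<lambda>\<tau>. \<Sum>n. ((\<integral>x. s x ^ n * f x \<partial>M) / fact n) * \<tau> ^ n) \<tau>"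
    by (rule isCont_powser_converges_everywhere) (use F sums_summable in fastforce)
  also have "(\<lambda>\<tau>. \<Sum>n. ((\<integral>x. s x ^ n * f x \<partial>M) / fact n) * \<tau> ^ n) = (\<lambda>\<tau>. \<integral>x. exp (\<tau> * s x) * f x \<partial>M)"
    using F by (intro ext) (simp add: sums_iff)
  finally show ?thesis .
qed

end

section \<open>Reconstruction of the nonlinear projection\<close>

lemma Linf_plusI:
  assumes [measurable]: "f \<in> borel_measurable M" and c: "0 < c" and b: "AE x in M. c \<le> f x \<and> f x \<le> C"
  shows "f \<in> Linf_plus M"
proof -
  have "AE x in M. ereal \<bar>f x\<bar> \<le> ereal C" "AE x in M. - ereal (f x) \<le> - ereal c"
    using b by (eventually_elim, use c in simp)+
  then have "esssup M (\<lambda>x. ereal \<bar>f x\<bar>) \<le> ereal C" "esssup M (\<lambda>x. - ereal (f x)) \<le> - ereal c"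
    by (auto intro!: esssup_I)
  moreover from this(2) have "- (- ereal c) \<le> - esssup M (\<lambda>x. - ereal (f x))"
    by (simp only: ereal_minus_le_minus)
  then have "0 < essinf M f"
    unfolding essinf_def using c by (simp only: ereal_uminus_uminus) (rule less_le_trans[of 0 "ereal c"], simp_all)
  ultimately show ?thesis
    by (auto simp: Linf_plus_def Linf_def intro: le_less_trans)
qed

section \<open>The projection as a conditional expectation\<close>

context exponent_interval begin

abbreviation F :: "real measure" where "F \<equiv> vimage_algebra {a<..<b} p borel"
abbreviation N :: "real measure" where "N \<equiv> sigma_exponent a b p"

lemma N_eq: "N = restr_to_subalg I F"
  by (simp add: sigma_exponent_def)

lemma sets_F: "sets F = {p -` A \<inter> {a<..<b} |A. A \<in> sets borel}"
  by (simp add: sets_vimage_algebra2)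

lemma subalgebra_F: "subalgebra I F"
  unfolding subalgebra_def sets_F using measurable_sets[OF p_meas] by auto

sublocale I: finite_measure_subalgebra I F
  by unfold_locales (rule subalgebra_F)

lemma exponent_measurable_F [measurable]: "p \<in> borel_measurable F"
  by (rule measurable_vimage_algebra1) simp

lemma rate_measurable_F: "rate \<in> borel_measurable F"
  unfolding rate_def[abs_def] by measurable

text \<open>The conditional expectation inherits the bound \<open>B\<close>, hence is square
  integrable and orthogonal to the error; this gives the choice in \<open>orth_proj\<close> a
  witness. Conversely, whatever is chosen has the averages over sets of \<open>F\<close> that
  characterise the conditional expectation.\<close>

lemma orth_proj_cond_exp:
  assumes f [measurable]: "f \<in> borel_measurable I" and B: "AE x in I. \<bar>f x\<bar> \<le> B"
  shows "orth_proj I N f \<in> borel_measurable F"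
    "AE x in I. orth_proj I N f x = real_cond_exp I F f x"
proof -
  define Q where "Q g \<longleftrightarrow> g \<in> L2 N \<and> (\<forall>h\<in>L2 N. (\<integral>x. (f x - g x) * h x \<partial>I) = 0)" for g
  have N_fin: "finite_measure N"
    unfolding N_eq by (rule finite_measure_restr_to_subalg[OF subalgebra_F I.finite_measure_axioms])
  have fi: "integrable I f" by (rule integrable_bounded_I[OF f B])
  have L2_int: "integrable I h" "h \<in> borel_measurable F" if "h \<in> L2 N" for h
  proof -
    have h: "h \<in> borel_measurable N" "integrable N (\<lambda>x. (h x)\<^sup>2)"
      using that by (auto simp: L2_def)
    have "integrable N h"
      by (rule finite_measure.square_integrable_imp_integrable[OF N_fin h])
    then show "integrable I h"
      unfolding N_eq by (rule integrable_from_subalg[OF subalgebra_F])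
    show "h \<in> borel_measurable F"
      using h(1) unfolding N_eq by (rule measurable_in_subalg'[OF subalgebra_F])
  qed
  have bounded_L2: "h \<in> L2 N" if h [measurable]: "h \<in> borel_measurable F" and hb: "AE x in I. \<bar>h x\<bar> \<le> C" for h C
  proof -
    have "AE x in I. norm ((h x)\<^sup>2) \<le> C\<^sup>2"
      using hb by eventually_elim (auto simp: abs_le_square_iff[symmetric])
    moreover have h2: "(\<lambda>x. (h x)\<^sup>2) \<in> borel_measurable F"
      by measurable
    ultimately have "integrable I (\<lambda>x. (h x)\<^sup>2)"
      by (intro I.integrable_const_bound measurable_from_subalg[OF subalgebra_F h2])
    then have "integrable N (\<lambda>x. (h x)\<^sup>2)"
      unfolding N_eq by (rule integrable_in_subalg[OF subalgebra_F h2])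
    moreover have "h \<in> borel_measurable N"
      unfolding N_eq by (rule measurable_in_subalg[OF subalgebra_F h])
    ultimately show ?thesis by (simp add: L2_def)
  qed
  have fB: "AE x in I. f x \<le> B" "AE x in I. - B \<le> f x"
    using B by (auto elim: eventually_mono)
  from I.real_cond_exp_le_c[OF fi fB(1)] I.real_cond_exp_ge_c[OF fi fB(2)] have "AE x in I. \<bar>real_cond_exp I F f x\<bar> \<le> B"
    by eventually_elim auto
  then have "real_cond_exp I F f \<in> L2 N"
    by (rule bounded_L2[rotated]) simp
  moreover have "(\<integral>x. (f x - real_cond_exp I F f x) * h x \<partial>I) = 0" if h: "h \<in> L2 N" for h
  proof -
    have [measurable]: "h \<in> borel_measurable F" "h \<in> borel_measurable I"
      using L2_int[OF h] by auto
    have "integrable I (\<lambda>x. h x * f x)"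
    proof (rule Bochner_Integration.integrable_bound)
      show "integrable I (\<lambda>x. B * h x)" using L2_int[OF h] by simp
      show "AE x in I. norm (h x * f x) \<le> norm (B * h x)"
        using B by eventually_elim (auto simp: abs_mult mult.commute intro!: mult_right_mono)
    qed measurable
    from this I.real_cond_exp_intg[OF this L2_int(2)[OF h] f]
    show ?thesis by (simp add: left_diff_distrib right_diff_distrib mult.commute)
  qed
  ultimately have "Q (real_cond_exp I F f)" by (auto simp: Q_def)
  then have "Q (orth_proj I N f)"
    unfolding orth_proj_def Q_def[symmetric] by (rule someI[of Q])
  then have g: "orth_proj I N f \<in> L2 N"
    and orth: "\<And>h. h \<in> L2 N \<Longrightarrow> (\<integral>x. (f x - orth_proj I N f x) * h x \<partial>I) = 0"
    by (auto simp: Q_def)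
  show gF: "orth_proj I N f \<in> borel_measurable F" by (rule L2_int[OF g])
  have gi: "integrable I (orth_proj I N f)" by (rule L2_int[OF g])
  have "AE x in I. real_cond_exp I F f x = orth_proj I N f x"
  proof (rule I.real_cond_exp_charact[OF _ fi gi gF])
    fix A assume A: "A \<in> sets F"
    then have AI: "A \<in> sets I" using subalgebra_F by (auto simp: subalgebra_def)
    \<comment> \<open>Orthogonality to indicators is equality of averages over
      \<open>A\<close>.\<close>
    have "(indicator A :: real \<Rightarrow> real) \<in> L2 N"
      by (rule bounded_L2[where C=1]) (use A in \<open>auto simp: indicator_def\<close>)
    from orth[OF this] show "(\<integral>x\<in>A. f x \<partial>I) = (\<integral>x\<in>A. orth_proj I N f x \<partial>I)"
      using integrable_mult_indicator[OF AI fi] integrable_mult_indicator[OF AI gi]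
      by (simp add: left_diff_distrib right_diff_distrib set_lebesgue_integral_def mult.commute)
  qed
  then show "AE x in I. orth_proj I N f x = real_cond_exp I F f x"
    by eventually_elim simp
qed

lemma nonlinear_proj_eq:
  "nonlinear_proj a b p \<gamma> x = orth_proj I N (resistance \<gamma>) x powr (- (p x - 1))"
  by (simp add: nonlinear_proj_def resistance_def[abs_def])

lemma resistance_abs_bounds:
  assumes "\<gamma> \<in> Linf_plus I"
  obtains C where "AE x in I. \<bar>resistance \<gamma> x\<bar> \<le> C" "resistance \<gamma> \<in> borel_measurable I"
proof -
  obtain c C where c: "0 < c" and b: "AE x in I. c \<le> resistance \<gamma> x \<and> resistance \<gamma> x \<le> C"
    and m: "resistance \<gamma> \<in> borel_measurable I"
    by (rule resistance_bounds[OF assms])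
  from b have "AE x in I. \<bar>resistance \<gamma> x\<bar> \<le> C"
    by eventually_elim (use c in auto)
  with m show thesis by (rule that[rotated])
qed

lemma orth_proj_resistance:
  assumes \<gamma>: "\<gamma> \<in> Linf_plus I"
  shows "orth_proj I N (resistance \<gamma>) \<in> borel_measurable F"
    "AE x in I. orth_proj I N (resistance \<gamma>) x = real_cond_exp I F (resistance \<gamma>) x"
proof -
  obtain C where "AE x in I. \<bar>resistance \<gamma> x\<bar> \<le> C" "resistance \<gamma> \<in> borel_measurable I"
    by (rule resistance_abs_bounds[OF \<gamma>])
  from orth_proj_cond_exp[OF this(2,1)]
  show "orth_proj I N (resistance \<gamma>) \<in> borel_measurable F"
    "AE x in I. orth_proj I N (resistance \<gamma>) x = real_cond_exp I F (resistance \<gamma>) x" .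
qed

text \<open>Conditional expectation preserves constant bounds. The positive lower one keeps the
  outer negative power bounded.\<close>

lemma orth_proj_resistance_bounds:
  assumes \<gamma>: "\<gamma> \<in> Linf_plus I"
  obtains c C where "0 < c" "AE x in I. c \<le> orth_proj I N (resistance \<gamma>) x \<and> orth_proj I N (resistance \<gamma>) x \<le> C"
proof -
  obtain c C where c: "0 < c" and b: "AE x in I. c \<le> resistance \<gamma> x \<and> resistance \<gamma> x \<le> C"
    and m: "resistance \<gamma> \<in> borel_measurable I"
    by (rule resistance_bounds[OF \<gamma>])
  have b1: "AE x in I. c \<le> resistance \<gamma> x" and b2: "AE x in I. resistance \<gamma> x \<le> C"
    using b by (auto elim: eventually_mono)
  have "AE x in I. \<bar>resistance \<gamma> x\<bar> \<le> C"
    using b by eventually_elim (use c in auto)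
  then have i: "integrable I (resistance \<gamma>)" by (rule integrable_bounded_I[OF m])
  have "AE x in I. c \<le> orth_proj I N (resistance \<gamma>) x \<and> orth_proj I N (resistance \<gamma>) x \<le> C"
    using orth_proj_resistance(2)[OF \<gamma>] I.real_cond_exp_ge_c[OF i b1] I.real_cond_exp_le_c[OF i b2]
    by eventually_elim simp
  with c show thesis by (rule that)
qed

lemma nonlinear_proj_measurable_F:
  assumes \<gamma>: "\<gamma> \<in> Linf_plus I"
  shows "nonlinear_proj a b p \<gamma> \<in> borel_measurable F"
proof -
  have [measurable]: "orth_proj I N (resistance \<gamma>) \<in> borel_measurable F" by (rule orth_proj_resistance[OF \<gamma>])
  show ?thesis unfolding nonlinear_proj_eq[abs_def] by measurable
qed

lemma nonlinear_proj_bounds: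
  assumes \<gamma>: "\<gamma> \<in> Linf_plus I"
  obtains c C where "0 < c" "AE x in I. c \<le> nonlinear_proj a b p \<gamma> x \<and> nonlinear_proj a b p \<gamma> x \<le> C"
proof -
  obtain c C where c: "0 < c"
    and b: "AE x in I. c \<le> orth_proj I N (resistance \<gamma>) x \<and> orth_proj I N (resistance \<gamma>) x \<le> C"
    by (rule orth_proj_resistance_bounds[OF \<gamma>])
  have m: "orth_proj I N (resistance \<gamma>) \<in> borel_measurable I"
    by (rule measurable_from_subalg[OF subalgebra_F orth_proj_resistance(1)[OF \<gamma>]])
  have e: "(\<lambda>x. - (p x - 1)) \<in> borel_measurable I" by measurable
  have eb: "AE x in I. - (pp - 1) \<le> - (p x - 1) \<and> - (p x - 1) \<le> - (pm - 1)"
    using p_AE by eventually_elim auto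
  obtain c' C' where "0 < c'" "AE x in I. c' \<le> orth_proj I N (resistance \<gamma>) x powr - (p x - 1) \<and>
     orth_proj I N (resistance \<gamma>) x powr - (p x - 1) \<le> C'"
    by (rule bounded_powr[OF m b c e eb])
  then show thesis using that unfolding nonlinear_proj_eq by blast
qed

lemma nonlinear_proj_mem:
  assumes \<gamma>: "\<gamma> \<in> Linf_plus I"
  shows "nonlinear_proj a b p \<gamma> \<in> Linf_plus I" "nonlinear_proj a b p \<gamma> \<in> L2 N \<inter> Linf_plus N"
proof -
  obtain c C where c: "0 < c" and b: "AE x in I. c \<le> nonlinear_proj a b p \<gamma> x \<and> nonlinear_proj a b p \<gamma> x \<le> C"
    by (rule nonlinear_proj_bounds[OF \<gamma>])
  note m [measurable] = nonlinear_proj_measurable_F[OF \<gamma>]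
  have mN [measurable]: "nonlinear_proj a b p \<gamma> \<in> borel_measurable N"
    unfolding N_eq by (rule measurable_in_subalg[OF subalgebra_F m])
  have mI [measurable]: "nonlinear_proj a b p \<gamma> \<in> borel_measurable I"
    by (rule measurable_from_subalg[OF subalgebra_F m])
  show "nonlinear_proj a b p \<gamma> \<in> Linf_plus I"
    by (rule Linf_plusI[OF mI c b])
  have bN: "AE x in N. c \<le> nonlinear_proj a b p \<gamma> x \<and> nonlinear_proj a b p \<gamma> x \<le> C"
    unfolding N_eq by (rule AE_restr_to_subalg2[OF subalgebra_F b]) measurable
  have "integrable N (\<lambda>x. (nonlinear_proj a b p \<gamma> x)\<^sup>2)"
  proof (rule finite_measure.integrable_const_bound)
    show "finite_measure N"
      unfolding N_eq by (rule finite_measure_restr_to_subalg[OF subalgebra_F I.finite_measure_axioms])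
    show "AE x in N. norm ((nonlinear_proj a b p \<gamma> x)\<^sup>2) \<le> C\<^sup>2"
      using bN by eventually_elim (use c in \<open>auto intro!: power_mono\<close>)
  qed measurable
  then show "nonlinear_proj a b p \<gamma> \<in> L2 N \<inter> Linf_plus N"
    using Linf_plusI[OF mN c bN] by (simp add: L2_def)
qed

text \<open>The exponents \<open>- (p x - 1)\<close> and \<open>- 1 / (p x - 1)\<close> are inverse
  to each other, so the resistance of the projected conductivity is the positive function
  \<open>?g\<close>. Being \<open>F\<close>-measurable, it is its own conditional
  expectation.\<close>

lemma nonlinear_proj_idem:
  assumes \<gamma>: "\<gamma> \<in> Linf_plus I"
  shows "AE x in I. nonlinear_proj a b p (nonlinear_proj a b p \<gamma>) x = nonlinear_proj a b p \<gamma> x"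
proof -
  let ?\<eta> = "nonlinear_proj a b p \<gamma>" and ?g = "orth_proj I N (resistance \<gamma>)"
  have \<eta>: "?\<eta> \<in> Linf_plus I" by (rule nonlinear_proj_mem[OF \<gamma>])
  obtain c C where c: "0 < c" and b: "AE x in I. c \<le> ?g x \<and> ?g x \<le> C"
    by (rule orth_proj_resistance_bounds[OF \<gamma>])
  have gF: "?g \<in> borel_measurable F" by (rule orth_proj_resistance[OF \<gamma>])
  have gI: "?g \<in> borel_measurable I" by (rule measurable_from_subalg[OF subalgebra_F gF])
  have "AE x in I. \<bar>?g x\<bar> \<le> C" using b by eventually_elim (use c in auto)
  then have gi: "integrable I ?g" by (rule integrable_bounded_I[OF gI])
  obtain C' where r: "AE x in I. \<bar>resistance ?\<eta> x\<bar> \<le> C'" "resistance ?\<eta> \<in> borel_measurable I"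
    by (rule resistance_abs_bounds[OF \<eta>])
  have "AE x in I. resistance ?\<eta> x = ?g x"
    using b p_AE
  proof eventually_elim
    case (elim x)
    then have "p x - 1 \<noteq> 0" "0 < ?g x" using pm c by auto
    moreover from this(1) have "- (p x - 1) * (- 1 / (p x - 1)) = 1" by (simp add: field_simps)
    ultimately show ?case
      by (simp only: resistance_def[of ?\<eta>] nonlinear_proj_eq powr_powr) simp
  qed
  from I.real_cond_exp_cong[OF this r(2) gI] I.real_cond_exp_F_meas[OF gi gF] orth_proj_resistance(2)[OF \<eta>]
  have "AE x in I. orth_proj I N (resistance ?\<eta>) x = ?g x"
    by eventually_elim simp
  then show ?thesis
    by eventually_elim (simp add: nonlinear_proj_eq)
qed

section \<open>Boundary difference as a function of the logarithmic flux\<close>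

lemma rate_abs_bound: "AE x in I. \<bar>rate x\<bar> \<le> 1 / (pm - 1)"
proof -
  have "0 < 1 / (pp - 1)" using pm pm_less_pp by simp
  from rate_bounds show ?thesis
    by eventually_elim (use \<open>0 < 1 / (pp - 1)\<close> in linarith)
qed

lemma flux_drop_exp: "flux_drop \<gamma> (exp \<tau>) = (\<integral>x. exp (\<tau> * rate x) * resistance \<gamma> x \<partial>I)"
  by (simp add: flux_drop_def powr_def mult.commute)

lemma continuous_flux_drop:
  assumes \<gamma>: "\<gamma> \<in> Linf_plus I"
  shows "isCont (\<lambda>\<tau>. flux_drop \<gamma> (exp \<tau>)) \<tau>"
proof -
  obtain C where r: "AE x in I. \<bar>resistance \<gamma> x\<bar> \<le> C" "resistance \<gamma> \<in> borel_measurable I"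
    by (rule resistance_abs_bounds[OF \<gamma>])
  show ?thesis
    unfolding flux_drop_exp by (rule I.continuous_exp_integral[OF rate_measurable r(2) rate_abs_bound r(1)])
qed

lemma integrable_exp_resistance:
  assumes \<gamma>: "\<gamma> \<in> Linf_plus I"
  shows "integrable I (\<lambda>x. exp (\<tau> * rate x) * resistance \<gamma> x)"
proof -
  obtain c C where c: "0 < c" and b: "AE x in I. c \<le> exp \<tau> powr rate x * resistance \<gamma> x \<and> exp \<tau> powr rate x * resistance \<gamma> x \<le> C"
    and m: "(\<lambda>x. exp \<tau> powr rate x * resistance \<gamma> x) \<in> borel_measurable I"
    by (rule powr_rate_resistance_bounds[OF \<gamma>, of "exp \<tau>"]) simp
  have "AE x in I. \<bar>exp \<tau> powr rate x * resistance \<gamma> x\<bar> \<le> C"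
    using b by eventually_elim (use c in linarith)
  from integrable_bounded_I[OF m this] show ?thesis
    by (simp add: powr_def mult.commute)
qed

text \<open>Intermediate values between two explicit logarithmic fluxes, both estimated by
  \<open>1 + x \<le> exp x\<close>.\<close>

lemma flux_drop_surj:
  assumes \<gamma>: "\<gamma> \<in> Linf_plus I" and m: "0 < m"
  obtains \<tau> where "flux_drop \<gamma> (exp \<tau>) = m"
proof -
  obtain c C where c: "0 < c" and b: "AE x in I. c \<le> resistance \<gamma> x \<and> resistance \<gamma> x \<le> C"
    and rm: "resistance \<gamma> \<in> borel_measurable I"
    by (rule resistance_bounds[OF \<gamma>])
  \<comment> \<open>An essential lower bound for \<open>rate\<close>, positive because
    \<open>pp\<close> is finite; it forces the drop to 0 and to infinity at the two ends.\<close>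
  define \<sigma> where "\<sigma> = 1 / (pp - 1)"
  have \<sigma>: "0 < \<sigma>" using pm pm_less_pp by (simp add: \<sigma>_def)
  have meas: "measure I (space I) = b - a"
    using emeasure_I ab by (simp add: measure_def)
  have "AE x in I. c \<le> C" using b by eventually_elim auto
  then have "0 < C" using c ae_filter_I by simp
  define K where "K = c * (b - a) * \<sigma>"
  have K: "0 < K" using c ab \<sigma> by (simp add: K_def)
  \<comment> \<open>Chosen so that the linear term \<open>\<tau>1 * K\<close> of the lower bound is
    already \<open>m\<close>.\<close>
  define \<tau>1 where "\<tau>1 = m / K"
  have \<tau>1: "0 \<le> \<tau>1" using m K by (simp add: \<tau>1_def)
  have "m = \<tau>1 * K" using K by (simp add: \<tau>1_def)
  also have "\<dots> \<le> c * (b - a) + \<tau>1 * K" using c ab by simp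
  also have "\<dots> = (1 + \<tau>1 * \<sigma>) * c * (b - a)" by (simp add: K_def algebra_simps)
  also have "\<dots> = (\<integral>x. (1 + \<tau>1 * \<sigma>) * c \<partial>I)" by (simp add: meas del: space_I)
  also have "\<dots> \<le> flux_drop \<gamma> (exp \<tau>1)"
    unfolding flux_drop_exp
  proof (rule integral_mono_AE)
    show "AE x in I. (1 + \<tau>1 * \<sigma>) * c \<le> exp (\<tau>1 * rate x) * resistance \<gamma> x"
      using b rate_bounds
    proof eventually_elim
      case (elim x)
      have "\<sigma> \<le> rate x" using elim by (simp add: \<sigma>_def)
      then have "1 + \<tau>1 * \<sigma> \<le> 1 + \<tau>1 * rate x"
        using \<tau>1 by (simp add: mult_left_mono)
      also have "\<dots> \<le> exp (\<tau>1 * rate x)" by (rule exp_ge_add_one_self)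
      finally show ?case
        using elim c by (intro mult_mono) auto
    qed
  qed (simp_all add: integrable_exp_resistance[OF \<gamma>])
  finally have u: "m \<le> flux_drop \<gamma> (exp \<tau>1)" .
  \<comment> \<open>Chosen so that \<open>exp (- (\<tau>0 * \<sigma>))\<close> exceeds
    \<open>C * (b - a) / m\<close>, which pushes the upper bound below \<open>m\<close>.\<close>
  define \<tau>0 where "\<tau>0 = - (C * (b - a) / (m * \<sigma>))"
  have \<tau>0: "\<tau>0 \<le> 0" using m \<open>0 < C\<close> ab \<sigma> by (simp add: \<tau>0_def)
  have "flux_drop \<gamma> (exp \<tau>0) \<le> (\<integral>x. exp (\<tau>0 * \<sigma>) * C \<partial>I)"
    unfolding flux_drop_exp
  proof (rule integral_mono_AE)
    show "AE x in I. exp (\<tau>0 * rate x) * resistance \<gamma> x \<le> exp (\<tau>0 * \<sigma>) * C"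
      using b rate_bounds
    proof eventually_elim
      case (elim x)
      have "\<sigma> \<le> rate x" using elim by (simp add: \<sigma>_def)
      then have "\<tau>0 * rate x \<le> \<tau>0 * \<sigma>"
        using \<tau>0 by (rule mult_left_mono_neg)
      then show ?case
        using elim c by (intro mult_mono) auto
    qed
  qed (simp_all add: integrable_exp_resistance[OF \<gamma>])
  also have "\<dots> = exp (\<tau>0 * \<sigma>) * (C * (b - a))" by (simp add: meas del: space_I)
  also have "\<dots> \<le> m"
  proof -
    have "C * (b - a) / m = - (\<tau>0 * \<sigma>)" using \<sigma> by (simp add: \<tau>0_def)
    then have "C * (b - a) / m \<le> exp (- (\<tau>0 * \<sigma>))"
      using exp_ge_add_one_self[of "- (\<tau>0 * \<sigma>)"] by linarith
    then show ?thesis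
      using m by (simp add: exp_minus field_simps)
  qed
  finally have l: "flux_drop \<gamma> (exp \<tau>0) \<le> m" .
  have "\<exists>\<tau>. \<tau>0 \<le> \<tau> \<and> \<tau> \<le> \<tau>1 \<and> flux_drop \<gamma> (exp \<tau>) = m"
    by (rule IVT[of "\<lambda>\<tau>. flux_drop \<gamma> (exp \<tau>)", OF l u]) (use \<tau>0 \<tau>1 continuous_flux_drop[OF \<gamma>] in auto)
  then show thesis using that by blast
qed

text \<open>The injectivity behind the reconstruction. Since \<open>r < 1\<close>, every boundary
  difference that occurs is positive, so it can be divided out of the data to recover the
  flux.\<close>

lemma nonlinear_proj_determined:
  assumes \<gamma>: "\<gamma> \<in> Linf_plus I" and \<eta>: "\<eta> \<in> Linf_plus I" and r: "0 < r" "r < 1"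
    and eq: "\<And>m. \<bar>m - 1\<bar> < r \<Longrightarrow> DN_map a b p \<gamma> (0, m) = DN_map a b p \<eta> (0, m)"
  shows "AE x in I. nonlinear_proj a b p \<gamma> x = nonlinear_proj a b p \<eta> x"
proof -
  obtain t where t: "flux_drop \<gamma> (exp t) = 1"
    by (rule flux_drop_surj[OF \<gamma>, of 1]) auto
  obtain \<delta> where \<delta>: "0 < \<delta>" and near: "\<And>u. \<bar>u - t\<bar> < \<delta> \<Longrightarrow> \<bar>flux_drop \<gamma> (exp u) - 1\<bar> < r"
  proof -
    from continuous_flux_drop[OF \<gamma>, of t] r(1) obtain d where "0 < d"
      "\<forall>u. dist u t < d \<longrightarrow> dist (flux_drop \<gamma> (exp u)) (flux_drop \<gamma> (exp t)) < r"
      unfolding continuous_at_eps_delta by blast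
    then show thesis using that[of d] by (auto simp: dist_real_def t)
  qed
  \<comment> \<open>Surjectivity supplies some logarithmic flux \<open>v\<close> at which
    \<open>\<eta>\<close> has the same drop; equal data then force \<open>v = u\<close>.\<close>
  have same: "flux_drop \<gamma> (exp u) = flux_drop \<eta> (exp u)" if u: "\<bar>u - t\<bar> < \<delta>" for u
  proof -
    define m where "m = flux_drop \<gamma> (exp u)"
    have m: "\<bar>m - 1\<bar> < r" using near[OF u] by (simp add: m_def)
    then have "0 < m" using r by linarith
    then obtain v where v: "flux_drop \<eta> (exp v) = m"
      by (rule flux_drop_surj[OF \<eta>])
    have "exp u * m = exp v * m"
      using DN_map_flux[OF \<gamma>, of "exp u" 0] DN_map_flux[OF \<eta>, of "exp v" 0] eq[OF m] v
      by (simp add: m_def)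
    then have "u = v" using \<open>0 < m\<close> by simp
    with v show ?thesis by (simp add: m_def)
  qed
  \<comment> \<open>The tilted weight: its exponential moments near 0 are the drops at logarithmic
    fluxes near \<open>t\<close>.\<close>
  define f where "f \<zeta> x = exp (t * rate x) * resistance \<zeta> x" for \<zeta> x
  have f_props: "\<exists>C. f \<zeta> \<in> borel_measurable I \<and> (AE x in I. 0 \<le> f \<zeta> x \<and> f \<zeta> x \<le> C)"
    if \<zeta>: "\<zeta> \<in> Linf_plus I" for \<zeta>
  proof -
    obtain c C where c: "0 < c" and b: "AE x in I. c \<le> exp t powr rate x * resistance \<zeta> x \<and> exp t powr rate x * resistance \<zeta> x \<le> C"
      and m: "(\<lambda>x. exp t powr rate x * resistance \<zeta> x) \<in> borel_measurable I"
      by (rule powr_rate_resistance_bounds[OF \<zeta>, of "exp t"]) simp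
    have fe: "f \<zeta> = (\<lambda>x. exp t powr rate x * resistance \<zeta> x)"
      by (simp add: f_def[abs_def] powr_def mult.commute)
    have "AE x in I. 0 \<le> f \<zeta> x \<and> f \<zeta> x \<le> C"
      unfolding fe using b by eventually_elim (use c in linarith)
    with m show ?thesis by (auto simp: fe)
  qed
  from f_props[OF \<gamma>] f_props[OF \<eta>] obtain C C' where
    fm: "f \<gamma> \<in> borel_measurable I" "f \<eta> \<in> borel_measurable I"
    and fb: "AE x in I. 0 \<le> f \<gamma> x \<and> f \<gamma> x \<le> C" "AE x in I. 0 \<le> f \<eta> x \<and> f \<eta> x \<le> C'" by blast
  have fi: "integrable I (f \<gamma>)" "integrable I (f \<eta>)"
    using integrable_exp_resistance[OF \<gamma>, of t] integrable_exp_resistance[OF \<eta>, of t] by (auto simp: f_def[abs_def])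
  have push: "(\<integral>x. indicator A (rate x) * f \<gamma> x \<partial>I) = (\<integral>x. indicator A (rate x) * f \<eta> x \<partial>I)"
    if A: "A \<in> sets borel" for A
  proof (rule I.exp_moments_unique[OF rate_measurable rate_abs_bound fm(1) fb(1) fm(2) fb(2) _ \<delta> _ A])
    show "0 < (\<integral>x. f \<gamma> x \<partial>I)"
      using t by (simp add: flux_drop_exp f_def)
    fix \<tau> assume "\<bar>\<tau>\<bar> < \<delta>"
    then show "(\<integral>x. exp (\<tau> * rate x) * f \<gamma> x \<partial>I) = (\<integral>x. exp (\<tau> * rate x) * f \<eta> x \<partial>I)"
      using same[of "\<tau> + t"] by (simp add: flux_drop_exp f_def mult.assoc[symmetric] exp_add[symmetric] distrib_right)
  qed
  have eq_exp: "AE x in I. real_cond_exp I F (f \<gamma>) x = real_cond_exp I F (f \<eta>) x"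
  proof (rule I.real_cond_exp_charact)
    fix B assume B: "B \<in> sets F"
    then obtain A where A: "A \<in> sets borel" "B = p -` A \<inter> {a<..<b}" by (auto simp: sets_F)
    \<comment> \<open>Since \<open>1 / 0 = 0\<close>, the map \<open>y \<mapsto> 1 + 1 / y\<close> inverts \<open>rate\<close> even where \<open>p x = 1\<close>.\<close>
    define A' where "A' = (\<lambda>y. 1 + 1 / y) -` A"
    have A': "A' \<in> sets borel"
      using measurable_sets[of "\<lambda>y::real. 1 + 1 / y" borel borel A] A by (simp add: A'_def)
    have ind: "indicator B x = (indicator A' (rate x) :: real)" if "x \<in> space I" for x
      using that by (auto simp: A A'_def rate_def indicator_def)
    have "(\<integral>x\<in>B. f \<zeta> x \<partial>I) = (\<integral>x. indicator A' (rate x) * f \<zeta> x \<partial>I)" for \<zeta>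
      unfolding set_lebesgue_integral_def
      by (rule Bochner_Integration.integral_cong) (simp_all add: ind del: space_I)
    then have "(\<integral>x\<in>B. f \<gamma> x \<partial>I) = (\<integral>x\<in>B. f \<eta> x \<partial>I)"
      using push[OF A'] by simp
    also have "\<dots> = (\<integral>x\<in>B. real_cond_exp I F (f \<eta>) x \<partial>I)"
      by (rule I.real_cond_exp_intA[OF fi(2) B])
    finally show "(\<integral>x\<in>B. f \<gamma> x \<partial>I) = (\<integral>x\<in>B. real_cond_exp I F (f \<eta>) x \<partial>I)" .
  qed (use fi I.real_cond_exp_int in auto)
  \<comment> \<open>The tilt depends on \<open>p\<close> only and is pulled out; as an exponential
    it can be cancelled afterwards.\<close>
  have mult: "AE x in I. real_cond_exp I F (f \<zeta>) x = exp (t * rate x) * orth_proj I N (resistance \<zeta>) x"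
    if \<zeta>: "\<zeta> \<in> Linf_plus I" for \<zeta>
  proof -
    have [measurable]: "rate \<in> borel_measurable F" by (rule rate_measurable_F)
    obtain C where "AE x in I. \<bar>resistance \<zeta> x\<bar> \<le> C" and rm: "resistance \<zeta> \<in> borel_measurable I"
      by (rule resistance_abs_bounds[OF \<zeta>])
    have "(\<lambda>x. exp (t * rate x)) \<in> borel_measurable F" by measurable
    from I.real_cond_exp_mult[OF this rm integrable_exp_resistance[OF \<zeta>, of t]] orth_proj_resistance(2)[OF \<zeta>]
    show ?thesis unfolding f_def[abs_def] by eventually_elim simp
  qed
  from eq_exp mult[OF \<gamma>] mult[OF \<eta>]
  have "AE x in I. orth_proj I N (resistance \<gamma>) x = orth_proj I N (resistance \<eta>) x"
    by eventually_elim simp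
  then show ?thesis
    by eventually_elim (simp add: nonlinear_proj_eq)
qed

text \<open>\<open>R\<close> projects an arbitrary conductivity that reproduces the given data; the
  true one shows that such a conductivity exists. Restricting to \<open>U\<close> makes equality of
  data mean agreement on \<open>U\<close> alone.\<close>

lemma reconstruction:
  assumes U: "ball (0, 1) r \<subseteq> U" and r: "0 < r" "r < 1"
  shows "\<exists>R :: (real \<times> real \<Rightarrow> real) \<Rightarrow> real \<Rightarrow> real. \<forall>\<gamma> \<in> Linf_plus I.
    AE x in I. R (restrict (DN_map a b p \<gamma>) U) x = nonlinear_proj a b p \<gamma> x"
proof (intro exI ballI)
  let ?\<Lambda> = "\<lambda>\<gamma>. restrict (DN_map a b p \<gamma>) U"
  let ?\<eta> = "\<lambda>d. SOME \<eta>. \<eta> \<in> Linf_plus I \<and> ?\<Lambda> \<eta> = d"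
  fix \<gamma> assume \<gamma>: "\<gamma> \<in> Linf_plus I"
  then have ex: "\<gamma> \<in> Linf_plus I \<and> ?\<Lambda> \<gamma> = ?\<Lambda> \<gamma>" by simp
  have \<eta>: "?\<eta> (?\<Lambda> \<gamma>) \<in> Linf_plus I \<and> ?\<Lambda> (?\<eta> (?\<Lambda> \<gamma>)) = ?\<Lambda> \<gamma>"
    by (rule someI[of "\<lambda>\<eta>. \<eta> \<in> Linf_plus I \<and> ?\<Lambda> \<eta> = ?\<Lambda> \<gamma>", OF ex])
  show "AE x in I. (\<lambda>d. nonlinear_proj a b p (?\<eta> d)) (?\<Lambda> \<gamma>) x = nonlinear_proj a b p \<gamma> x"
  proof (rule nonlinear_proj_determined[OF _ \<gamma> r])
    show "?\<eta> (?\<Lambda> \<gamma>) \<in> Linf_plus I" using \<eta> by blast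
    fix m :: real assume "\<bar>m - 1\<bar> < r"
    \<comment> \<open>The data enter on the segment through \<open>(0, 1)\<close> with left value
      0.\<close>
    then have "(0, m) \<in> U"
      using U by (auto simp: dist_Pair_Pair dist_real_def)
    with \<eta> show "DN_map a b p (?\<eta> (?\<Lambda> \<gamma>)) (0, m) = DN_map a b p \<gamma> (0, m)"
      by (metis (no_types, lifting) restrict_apply')
  qed
qed

end

theorem theorem1:
  fixes a b pm pp :: real and p :: "real \<Rightarrow> real"
  assumes "a < b"
    and "p \<in> borel_measurable (interval_measure_space a b)"
    and "1 < pm"
    and "AE x in interval_measure_space a b. pm < p x \<and> p x < pp"
  defines "M \<equiv> interval_measure_space a b"
    and "N \<equiv> sigma_exponent a b p"
  shows
    "(\<forall>\<gamma> \<in> L2 M \<inter> Linf_plus M. nonlinear_proj a b p \<gamma> \<in> L2 N \<inter> Linf_plus N)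
   \<and> (\<forall>\<gamma> \<in> L2 M \<inter> Linf_plus M.
        AE x in M. nonlinear_proj a b p (nonlinear_proj a b p \<gamma>) x = nonlinear_proj a b p \<gamma> x)
   \<and> (\<exists>R :: (real \<times> real \<Rightarrow> real) \<Rightarrow> real \<Rightarrow> real.
        \<forall>\<gamma> \<in> Linf_plus M. AE x in M. R (DN_map a b p \<gamma>) x = nonlinear_proj a b p \<gamma> x)
   \<and> (\<forall>\<epsilon>>0. \<exists>U :: (real \<times> real) set. open U \<and> U \<noteq> {} \<and> bounded U \<and> diameter U < \<epsilon> \<and>
        (\<exists>R :: (real \<times> real \<Rightarrow> real) \<Rightarrow> real \<Rightarrow> real.
           \<forall>\<gamma> \<in> Linf_plus M.
             AE x in M. R (restrict (DN_map a b p \<gamma>) U) x = nonlinear_proj a b p \<gamma> x))"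
proof -
  interpret exponent_interval a b pm pp p
    using assms(1-4) by unfold_locales
  show ?thesis
    unfolding M_def N_def
  proof (intro conjI ballI allI impI)
    show "nonlinear_proj a b p \<gamma> \<in> L2 (sigma_exponent a b p) \<inter> Linf_plus (sigma_exponent a b p)"
      "AE x in I. nonlinear_proj a b p (nonlinear_proj a b p \<gamma>) x = nonlinear_proj a b p \<gamma> x"
      if "\<gamma> \<in> L2 I \<inter> Linf_plus I" for \<gamma>
      using that nonlinear_proj_mem[of \<gamma>] nonlinear_proj_idem[of \<gamma>] by auto
    \<comment> \<open>For \<open>U = UNIV\<close> restriction changes nothing, which gives the
      global statement.\<close>
    show "\<exists>R :: (real \<times> real \<Rightarrow> real) \<Rightarrow> real \<Rightarrow> real.
        \<forall>\<gamma> \<in> Linf_plus I. AE x in I. R (DN_map a b p \<gamma>) x = nonlinear_proj a b p \<gamma> x"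
      using reconstruction[of "1/2" UNIV] by (simp add: restrict_UNIV)
  next
    fix \<epsilon> :: real assume \<epsilon>: "0 < \<epsilon>"
    \<comment> \<open>The divisor 3 leaves room for the diameter \<open>2 * r\<close> below
      \<open>\<epsilon>\<close>, and the cap at 1 gives \<open>r < 1\<close>.\<close>
    define r where "r = min \<epsilon> 1 / 3"
    have r: "0 < r" "r < 1" "2 * r < \<epsilon>" using \<epsilon> by (auto simp: r_def)
    let ?U = "ball (0 :: real, 1 :: real) r"
    have "diameter ?U \<le> 2 * r"
    proof (rule diameter_le)
      fix x y assume "x \<in> ?U" "y \<in> ?U"
      then show "norm (x - y) \<le> 2 * r"
        using dist_triangle2[of x y "(0, 1)"] by (auto simp: dist_norm[symmetric] dist_commute)
    qed (use r in auto)
    with r show "\<exists>U :: (real \<times> real) set. open U \<and> U \<noteq> {} \<and> bounded U \<and> diameter U < \<epsilon> \<and>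
        (\<exists>R :: (real \<times> real \<Rightarrow> real) \<Rightarrow> real \<Rightarrow> real.
           \<forall>\<gamma> \<in> Linf_plus I.
             AE x in I. R (restrict (DN_map a b p \<gamma>) U) x = nonlinear_proj a b p \<gamma> x)"
      using reconstruction[OF order.refl r(1,2)]
      by (intro exI[of _ ?U] conjI) auto
  qed
qed

end
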